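(* Let $A=k(Q,I)$ be a string algebra. If $\overline{GSt}_{cp}\neq\emptyset$ or $\overline{GSt}^{cp}\neq\emptyset$, then $\mathrm{gl.dim}\,A=\infty$.
   Context: **Algebras.** $k$ is an algebraically closed field, $Q$ a finite quiver with vertex set $Q_0$, arrow set $Q_1$, source and target maps $s,t$. Paths are written left to right: $w_1\cdots w_n$ is a path if $t(w_i)=s(w_{i+1})$. $I$ is an admissible ideal of $kQ$ and $A=kQ/I=k(Q,I)$ (finite-dimensional). $A$ is a *string algebra* if (1) every vertex is the source of at most two arrows and the target of at most two arrows; (2) for every $a\in Q_1$ there is at most one $b\in Q_1$ with $s(b)=t(a)$ and $ab\notin I$; (3) for every $a\in Q_1$ there is at most one $c\in Q_1$ with $t(c)=s(a)$ and $ca\notin I$; (4) $I$ is generated by zero relations, i.e. by paths of length $\ge 2$. $\mathbf{Pa}_{>0}$ is the set of paths of $Q$ of positive length not in $I$. Modules are finitely generated left modules, $P_i=Ae_i$ ($e_i$ the trivial path at $i$). A path $w\in\mathbf{Pa}_{>0}$ from $r$ to $s$ defines $p(w):P_r\to P_s$, $u\mapsto uw$. $\mathrm{gl.dim}\,A$ is the supremum of the projective dimensions of all (finitely generated left) $A$-modules. **Generalized strings.** Each arrow $a$ has a formal inverse $a^{-1}$ with $s(a^{-1})=t(a)$, $t(a^{-1})=s(a)$; inverses of paths are $(a_1\cdots a_n)^{-1}=a_n^{-1}\cdots a_1^{-1}$. A walk (resp. generalized walk) of length $n>0$ is a sequence $w_1\cdots w_n$ where each $w_i$ is $p$ or $p^{-1}$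 with $p$ an arrow (resp. a path of positive length), $t(w_i)=s(w_{i+1})$; its inverse is $w_n^{-1}\cdots w_1^{-1}$. A string is a walk with $w_{i+1}\ne w_i^{-1}$ for all $i<n$ such that no sub-word of $w$ or $w^{-1}$ is in $I$; $St$ is the set of strings. $\overline{GSt}$ is the set of generalized walks $w=w_1\cdot w_2\cdots w_n$ such that for all $i$: if $w_i,w_{i+1}\in\mathbf{Pa}_{>0}$ then $w_iw_{i+1}\in I$; if $w_i^{-1},w_{i+1}^{-1}\in\mathbf{Pa}_{>0}$ then $w_{i+1}^{-1}w_i^{-1}\in I$; if $w_i,w_{i+1}^{-1}\in\mathbf{Pa}_{>0}$ or $w_i^{-1},w_{i+1}\in\mathbf{Pa}_{>0}$ then $w_iw_{i+1}\in St$. $GSt$ (the generalized strings) is a fixed set of representatives of $\overline{GSt}$ modulo $u\sim w\iff u\in\{w,w^{-1}\}$, together with all trivial paths. For a generalized walk $w$ of length $n$, $\mu_w(0)=0$, $\mu_w(i)=\mu_w(i-1)+1$ if $w_i\in\mathbf{Pa}_{>0}$ and $\mu_w(i)=\mu_w(i-1)-1$ if $w_i^{-1}\in\mathbf{Pa}_{>0}$; $\mu(w)=\min_{0\le i\le n}\mu_w(i)$. **Special sets.** For $p,w\in\mathbf{Pa}_{>0}$ with $t(p)=s(w)$ and $pw=0$ in $A$, $p$ is *minimal for $w$* if no proper sub-path $p'$ of $p$ with $t(p')=s(w)$ satisfies $p'w=0$. $\mathbf{Pa}_c$ is the set of $p\in\mathbf{Pa}_{>0}$ for which there exist $p_m,p_{m-1},\dots,p_1\in\mathbf{Pa}_{>0}$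 such that, with $p_{m+1}=p$, $t(p_i)=s(p_{i+1})$ for $i=1,\dots,m$, $s(p_1)=t(p_j)$ for some $1\le j\le m+1$, $p_ip_{i+1}=0$ for $i=1,\dots,m$ and $p_jp_1=0$ in $A$, with $p_i$ minimal for $p_{i+1}$ ($i=1,\dots,m$) and $p_j$ minimal for $p_1$. $\overline{GSt}_{cp}$ is the set of generalized strings $w=w_1\cdots w_n$ of positive length with $\mu(w)=0$ for which there exists $p\in\mathbf{Pa}_c$ such that $p\cdot w\in GSt$ with $p$ minimal for $w_1$, or $p\in\ker p(w_l^{-1})\cap\ker p(w_{l+1})$ for some even index $l>0$ with $\mu_w(l)=0$, with $p$ minimal for $w_l^{-1}$ and $w_{l+1}$. $\overline{GSt}^{cp}$ is the set of generalized strings $w=w_1\cdots w_n$ of positive length with $\mu(w)=\mu_w(n)$ for which there exists $p\in\mathbf{Pa}_c$ with $w\cdot p^{-1}\in GSt$. *)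

theory Defs
  imports
    "Graph_Theory.Arc_Walk"
    "HOL-Algebra.QuotRing"
    "HOL-Algebra.Ideal_Product"
    "HOL-Algebra.Module"
    "HOL-Computational_Algebra.Polynomial"
    "HOL-Library.Extended_Nat"
    "HOL-Library.Sublist"
begin

section \<open>Homological dimension of a ring\<close>

text \<open>
  The module locale of HOL-Algebra is restricted to commutative rings; the axioms below are the
  same ones over an arbitrary ring. The multiplicative fields of the module record play no role.
\<close>

locale left_module = R?: ring R + M?: abelian_group M
  for R :: "('r, 'e) ring_scheme" (structure)
    and M :: "('r, 'm, 'f) module_scheme" (structure) +
  assumes smult_closed:
      "\<lbrakk>a \<in> carrier R; x \<in> carrier M\<rbrakk> \<Longrightarrow> a \<odot>\<^bsub>M\<^esub> x \<in> carrier M"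
    and smult_l_distr:
      "\<lbrakk>a \<in> carrier R; b \<in> carrier R; x \<in> carrier M\<rbrakk> \<Longrightarrow>
        (a \<oplus>\<^bsub>R\<^esub> b) \<odot>\<^bsub>M\<^esub> x = a \<odot>\<^bsub>M\<^esub> x \<oplus>\<^bsub>M\<^esub> b \<odot>\<^bsub>M\<^esub> x"
    and smult_r_distr:
      "\<lbrakk>a \<in> carrier R; x \<in> carrier M; y \<in> carrier M\<rbrakk> \<Longrightarrow>
        a \<odot>\<^bsub>M\<^esub> (x \<oplus>\<^bsub>M\<^esub> y) = a \<odot>\<^bsub>M\<^esub> x \<oplus>\<^bsub>M\<^esub> a \<odot>\<^bsub>M\<^esub> y"
    and smult_assoc:
      "\<lbrakk>a \<in> carrier R; b \<in> carrier R; x \<in> carrier M\<rbrakk> \<Longrightarrow>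
        (a \<otimes>\<^bsub>R\<^esub> b) \<odot>\<^bsub>M\<^esub> x = a \<odot>\<^bsub>M\<^esub> (b \<odot>\<^bsub>M\<^esub> x)"
    and smult_one: "x \<in> carrier M \<Longrightarrow> \<one>\<^bsub>R\<^esub> \<odot>\<^bsub>M\<^esub> x = x"

text \<open>
  The objects of the category of finitely generated left modules. HOL cannot quantify over types
  inside a formula, so a universe is fixed: all carriers are sets of sequences of ring elements.
  This loses nothing, because a finitely generated module over \<open>R\<close> is isomorphic to a quotient of
  some \<open>R\<^sup>n\<close>, and choosing one representative in each coset realises it on a subset of \<open>R\<^sup>n\<close>.
\<close>

type_synonym 'r lmod = "('r, nat \<Rightarrow> 'r) module"

definition fg_left_module :: "'r ring \<Rightarrow> 'r lmod \<Rightarrow> bool" where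
  "fg_left_module R M \<longleftrightarrow> left_module R M \<and>
     (\<exists>S. finite S \<and> S \<subseteq> carrier M \<and>
        (\<forall>N. submodule N R M \<and> S \<subseteq> N \<longrightarrow> N = carrier M))"

definition module_hom :: "'r ring \<Rightarrow> 'r lmod \<Rightarrow> 'r lmod \<Rightarrow> ((nat \<Rightarrow> 'r) \<Rightarrow> (nat \<Rightarrow> 'r)) set" where
  "module_hom R M N = {f. f \<in> carrier M \<rightarrow> carrier N \<and>
     (\<forall>x\<in>carrier M. \<forall>y\<in>carrier M. f (x \<oplus>\<^bsub>M\<^esub> y) = f x \<oplus>\<^bsub>N\<^esub> f y) \<and>
     (\<forall>a\<in>carrier R. \<forall>x\<in>carrier M. f (a \<odot>\<^bsub>M\<^esub> x) = a \<odot>\<^bsub>N\<^esub> f x)}"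

definition projective_module :: "'r ring \<Rightarrow> 'r lmod \<Rightarrow> bool" where
  "projective_module R P \<longleftrightarrow> fg_left_module R P \<and>
     (\<forall>M N g f. fg_left_module R M \<and> fg_left_module R N \<and>
        g \<in> module_hom R M N \<and> g ` carrier M = carrier N \<and> f \<in> module_hom R P N \<longrightarrow>
        (\<exists>h\<in>module_hom R P M. \<forall>x\<in>carrier P. g (h x) = f x))"

definition has_projective_resolution :: "'r ring \<Rightarrow> 'r lmod \<Rightarrow> nat \<Rightarrow> bool" where
  "has_projective_resolution R M n \<longleftrightarrow> (\<exists>P d e.
     (\<forall>i. projective_module R (P i)) \<and>
     (\<forall>i>n. carrier (P i) = {\<zero>\<^bsub>P i\<^esub>}) \<and>
     e \<in> module_hom R (P 0) M \<and>
     (\<forall>i. d i \<in> module_hom R (P (Suc i)) (P i)) \<and>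
     e ` carrier (P 0) = carrier M \<and>
     d 0 ` carrier (P 1) = a_kernel (P 0) M e \<and>
     (\<forall>i. d (Suc i) ` carrier (P (Suc (Suc i))) = a_kernel (P (Suc i)) (P i) (d i)))"

text \<open>The infimum of the empty set is \<open>\<infinity>\<close>; the zero module gets dimension \<open>0\<close>.\<close>

definition proj_dim :: "'r ring \<Rightarrow> 'r lmod \<Rightarrow> enat" where
  "proj_dim R M = Inf {enat n | n. has_projective_resolution R M n}"

definition gl_dim :: "'r ring \<Rightarrow> enat" where
  "gl_dim R = (SUP M\<in>{M. fg_left_module R M}. proj_dim R M)"


section \<open>Path algebras and string algebras\<close>

text \<open>
  A quiver is a \<^typ>\<open>('v, 'a) pre_digraph\<close>, finite if it satisfies \<^locale>\<open>fin_digraph\<close>.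
  A path is stored with both end points, which is needed for the trivial paths \<open>(v, [], v)\<close>.
  The element of the path algebra with coefficients \<open>f\<close> is the function \<open>f\<close> itself, and the
  arrows of a path are listed in the order in which they are traversed.
\<close>

type_synonym ('v, 'a) qpath = "'v \<times> 'a list \<times> 'v"

definition qpaths :: "('v, 'a) pre_digraph \<Rightarrow> ('v, 'a) qpath set" where
  "qpaths Q = {(u, p, v). pre_digraph.awalk Q u p v}"

definition path_algebra :: "('v, 'a) pre_digraph \<Rightarrow> (('v, 'a) qpath \<Rightarrow> 'k::field) ring" where
  "path_algebra Q =
    \<lparr>carrier = {f. finite {x. f x \<noteq> 0} \<and> {x. f x \<noteq> 0} \<subseteq> qpaths Q},
     monoid.mult = (\<lambda>f g r. \<Sum>((u, p, v), (v', q, w)) \<in> {x. f x \<noteq> 0} \<times> {y. g y \<noteq> 0}.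
               if v = v' \<and> r = (u, p @ q, w) then f (u, p, v) * g (v', q, w) else 0),
     one = (\<lambda>r. if \<exists>v\<in>verts Q. r = (v, [], v) then 1 else 0),
     zero = (\<lambda>r. 0),
     add = (\<lambda>f g r. f r + g r)\<rparr>"

definition basis_elem :: "('v, 'a) qpath \<Rightarrow> ('v, 'a) qpath \<Rightarrow> 'k::field" where
  "basis_elem x = (\<lambda>y. if y = x then 1 else 0)"

text \<open>Paths of positive length are non-empty arrow lists; their end points are determined.\<close>

definition psrc :: "('v, 'a) pre_digraph \<Rightarrow> 'a list \<Rightarrow> 'v" where
  "psrc Q p = tail Q (hd p)"

definition ptgt :: "('v, 'a) pre_digraph \<Rightarrow> 'a list \<Rightarrow> 'v" where
  "ptgt Q p = head Q (last p)"

definition path_elem :: "('v, 'a) pre_digraph \<Rightarrow> 'a list \<Rightarrow> ('v, 'a) qpath \<Rightarrow> 'k::field" where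
  "path_elem Q p = basis_elem (psrc Q p, p, ptgt Q p)"

definition is_path :: "('v, 'a) pre_digraph \<Rightarrow> 'a list \<Rightarrow> bool" where
  "is_path Q p \<longleftrightarrow> p \<noteq> [] \<and> pre_digraph.awalk Q (psrc Q p) p (ptgt Q p)"

definition arrow_ideal :: "('v, 'a) pre_digraph \<Rightarrow> (('v, 'a) qpath \<Rightarrow> 'k::field) set" where
  "arrow_ideal Q = genideal (path_algebra Q) ((\<lambda>a. path_elem Q [a]) ` arcs Q)"

definition admissible_ideal ::
    "('v, 'a) pre_digraph \<Rightarrow> (('v, 'a) qpath \<Rightarrow> 'k::field) set \<Rightarrow> bool" where
  "admissible_ideal Q I \<longleftrightarrow> ideal I (path_algebra Q) \<and>
     I \<subseteq> arrow_ideal Q [^]\<^bsub>ideals_set (path_algebra Q :: (('v, 'a) qpath \<Rightarrow> 'k) ring)\<^esub> (2::nat) \<and>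
     (\<exists>m\<ge>2. arrow_ideal Q [^]\<^bsub>ideals_set (path_algebra Q :: (('v, 'a) qpath \<Rightarrow> 'k) ring)\<^esub> (m::nat)
        \<subseteq> I)"

definition string_algebra ::
    "('v, 'a) pre_digraph \<Rightarrow> (('v, 'a) qpath \<Rightarrow> 'k::field) set \<Rightarrow> bool" where
  "string_algebra Q I \<longleftrightarrow> fin_digraph Q \<and> admissible_ideal Q I \<and>
     (\<forall>v\<in>verts Q. card (out_arcs Q v) \<le> 2 \<and> card (in_arcs Q v) \<le> 2) \<and>
     (\<forall>a\<in>arcs Q. card {b\<in>arcs Q. tail Q b = head Q a \<and> path_elem Q [a, b] \<notin> I} \<le> 1) \<and>
     (\<forall>a\<in>arcs Q. card {c\<in>arcs Q. head Q c = tail Q a \<and> path_elem Q [c, a] \<notin> I} \<le> 1) \<and>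
     (\<exists>Z. (\<forall>p\<in>Z. is_path Q p \<and> length p \<ge> 2) \<and>
          I = genideal (path_algebra Q) (path_elem Q ` Z))"

text \<open>The algebra \<open>A = kQ/I\<close>, the residue class in \<open>A\<close> of a path of positive length, and the
  homomorphism \<open>P\<^sub>r \<rightarrow> P\<^sub>s, u \<mapsto> u w\<close> attached to a path \<open>w\<close> from \<open>r\<close> to \<open>s\<close>, where
  \<open>P\<^sub>i = A e\<^sub>i\<close>.\<close>

definition quiver_algebra ::
    "('v, 'a) pre_digraph \<Rightarrow> (('v, 'a) qpath \<Rightarrow> 'k::field) set \<Rightarrow>
     (('v, 'a) qpath \<Rightarrow> 'k) set ring" where
  "quiver_algebra Q I = path_algebra Q Quot I"

definition path_class ::
    "('v, 'a) pre_digraph \<Rightarrow> (('v, 'a) qpath \<Rightarrow> 'k::field) set \<Rightarrow> 'a list \<Rightarrow> (('v, 'a) qpath \<Rightarrow> 'k) set" where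
  "path_class Q I p = I +>\<^bsub>path_algebra Q\<^esub> path_elem Q p"

definition vertex_proj ::
    "('v, 'a) pre_digraph \<Rightarrow> (('v, 'a) qpath \<Rightarrow> 'k::field) set \<Rightarrow> 'v \<Rightarrow> (('v, 'a) qpath \<Rightarrow> 'k) set set" where
  "vertex_proj Q I i =
     {x \<otimes>\<^bsub>quiver_algebra Q I\<^esub> (I +>\<^bsub>path_algebra Q\<^esub> basis_elem (i, [], i)) | x.
        x \<in> carrier (quiver_algebra Q I)}"

definition path_hom ::
    "('v, 'a) pre_digraph \<Rightarrow> (('v, 'a) qpath \<Rightarrow> 'k::field) set \<Rightarrow> 'a list \<Rightarrow>
     (('v, 'a) qpath \<Rightarrow> 'k) set \<Rightarrow> (('v, 'a) qpath \<Rightarrow> 'k) set" where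
  "path_hom Q I w = (\<lambda>u. u \<otimes>\<^bsub>quiver_algebra Q I\<^esub> path_class Q I w)"

definition path_hom_kernel ::
    "('v, 'a) pre_digraph \<Rightarrow> (('v, 'a) qpath \<Rightarrow> 'k::field) set \<Rightarrow> 'a list \<Rightarrow> (('v, 'a) qpath \<Rightarrow> 'k) set set" where
  "path_hom_kernel Q I w =
     {u \<in> vertex_proj Q I (psrc Q w). path_hom Q I w u = \<zero>\<^bsub>quiver_algebra Q I\<^esub>}"

text \<open>The product of two paths vanishes in \<open>A\<close>.\<close>

definition zero_product ::
    "('v, 'a) pre_digraph \<Rightarrow> (('v, 'a) qpath \<Rightarrow> 'k::field) set \<Rightarrow> 'a list \<Rightarrow> 'a list \<Rightarrow> bool" where
  "zero_product Q I p w \<longleftrightarrow>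
     path_class Q I p \<otimes>\<^bsub>quiver_algebra Q I\<^esub> path_class Q I w = \<zero>\<^bsub>quiver_algebra Q I\<^esub>"

definition Pa :: "('v, 'a) pre_digraph \<Rightarrow> (('v, 'a) qpath \<Rightarrow> 'k::field) set \<Rightarrow> 'a list set" where
  "Pa Q I = {p. is_path Q p \<and> path_elem Q p \<notin> I}"


section \<open>Strings and generalized strings\<close>

text \<open>Letters are taken over arrows for walks, and over paths for generalized walks.\<close>

datatype 'p letter = Dir 'p | Inv 'p

fun letter_inv :: "'p letter \<Rightarrow> 'p letter" where
  "letter_inv (Dir p) = Inv p"
| "letter_inv (Inv p) = Dir p"

fun letter_src :: "('p \<Rightarrow> 'v) \<Rightarrow> ('p \<Rightarrow> 'v) \<Rightarrow> 'p letter \<Rightarrow> 'v" where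
  "letter_src s t (Dir p) = s p"
| "letter_src s t (Inv p) = t p"

fun letter_tgt :: "('p \<Rightarrow> 'v) \<Rightarrow> ('p \<Rightarrow> 'v) \<Rightarrow> 'p letter \<Rightarrow> 'v" where
  "letter_tgt s t (Dir p) = t p"
| "letter_tgt s t (Inv p) = s p"

definition word_inv :: "'p letter list \<Rightarrow> 'p letter list" where
  "word_inv w = rev (map letter_inv w)"

text \<open>Walks of positive length with letters from \<open>X\<close>, given source and target maps on \<open>X\<close>.
  Walk indices are shifted: the letter \<open>w\<^sub>i\<close> of the mathematical notation is \<open>w ! (i - 1)\<close>.\<close>

definition walk_over :: "('p \<Rightarrow> 'v) \<Rightarrow> ('p \<Rightarrow> 'v) \<Rightarrow> 'p set \<Rightarrow> 'p letter list \<Rightarrow> bool" where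
  "walk_over s t X w \<longleftrightarrow> w \<noteq> [] \<and> set w \<subseteq> Dir ` X \<union> Inv ` X \<and>
     (\<forall>i. Suc i < length w \<longrightarrow> letter_tgt s t (w ! i) = letter_src s t (w ! Suc i))"

definition St ::
    "('v, 'a) pre_digraph \<Rightarrow> (('v, 'a) qpath \<Rightarrow> 'k::field) set \<Rightarrow> 'a letter list set" where
  "St Q I = {w. walk_over (tail Q) (head Q) (arcs Q) w \<and>
     (\<forall>i. Suc i < length w \<longrightarrow> w ! Suc i \<noteq> letter_inv (w ! i)) \<and>
     (\<forall>q. q \<noteq> [] \<and> (sublist (map Dir q) w \<or> sublist (map Dir q) (word_inv w)) \<longrightarrow>
        path_elem Q q \<notin> I)}"

fun expand :: "'a list letter \<Rightarrow> 'a letter list" where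
  "expand (Dir p) = map Dir p"
| "expand (Inv p) = map Inv (rev p)"

fun consecutive_ok ::
    "('v, 'a) pre_digraph \<Rightarrow> (('v, 'a) qpath \<Rightarrow> 'k::field) set \<Rightarrow> 'a list letter \<Rightarrow> 'a list letter \<Rightarrow> bool" where
  "consecutive_ok Q I (Dir p) (Dir q) \<longleftrightarrow> path_elem Q (p @ q) \<in> I"
| "consecutive_ok Q I (Inv p) (Inv q) \<longleftrightarrow> path_elem Q (q @ p) \<in> I"
| "consecutive_ok Q I x y \<longleftrightarrow> expand x @ expand y \<in> St Q I"

text \<open>The set written with a bar: all generalized strings of positive length, before
  representatives are chosen. All letters are paths outside \<open>I\<close> or inverses of such.\<close>

definition GSt_bar ::
    "('v, 'a) pre_digraph \<Rightarrow> (('v, 'a) qpath \<Rightarrow> 'k::field) set \<Rightarrow> 'a list letter list set" where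
  "GSt_bar Q I = {w. walk_over (psrc Q) (ptgt Q) (Pa Q I) w \<and>
     (\<forall>i. Suc i < length w \<longrightarrow> consecutive_ok Q I (w ! i) (w ! Suc i))}"

datatype ('v, 'a) gstring = Trivial 'v | Word "'a list letter list"

text \<open>\<open>G\<close> is one possible choice of the set \<open>GSt\<close>: a system of representatives modulo inversion,
  together with the trivial paths.\<close>

definition is_GSt ::
    "('v, 'a) pre_digraph \<Rightarrow> (('v, 'a) qpath \<Rightarrow> 'k::field) set \<Rightarrow> ('v, 'a) gstring set \<Rightarrow> bool" where
  "is_GSt Q I G \<longleftrightarrow> (\<exists>T. T \<subseteq> GSt_bar Q I \<and>
     (\<forall>w\<in>GSt_bar Q I. \<exists>!u. u \<in> T \<and> u \<in> {w, word_inv w}) \<and>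
     G = Trivial ` verts Q \<union> Word ` T)"

fun height :: "'a list letter list \<Rightarrow> nat \<Rightarrow> int" where
  "height w 0 = 0"
| "height w (Suc i) = height w i + (case w ! i of Dir _ \<Rightarrow> 1 | Inv _ \<Rightarrow> - 1)"

definition min_height :: "'a list letter list \<Rightarrow> int" where
  "min_height w = Min (height w ` {0..length w})"


section \<open>The special sets\<close>

definition minimal_for ::
    "('v, 'a) pre_digraph \<Rightarrow> (('v, 'a) qpath \<Rightarrow> 'k::field) set \<Rightarrow> 'a list \<Rightarrow> 'a list \<Rightarrow> bool" where
  "minimal_for Q I p w \<longleftrightarrow> p \<in> Pa Q I \<and> w \<in> Pa Q I \<and> ptgt Q p = psrc Q w \<and>
     zero_product Q I p w \<and>
     \<not> (\<exists>p'. p' \<noteq> [] \<and> sublist p' p \<and> p' \<noteq> p \<and> ptgt Q p' = psrc Q w \<and> zero_product Q I p' w)"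

text \<open>Here \<open>P i\<close> is \<open>p\<^sub>i\<close> for \<open>1 \<le> i \<le> m + 1\<close>. Composability and vanishing of the products are part
  of \<^const>\<open>minimal_for\<close>.\<close>

definition Pa_c :: "('v, 'a) pre_digraph \<Rightarrow> (('v, 'a) qpath \<Rightarrow> 'k::field) set \<Rightarrow> 'a list set" where
  "Pa_c Q I = {p \<in> Pa Q I. \<exists>m\<ge>1. \<exists>P :: nat \<Rightarrow> 'a list. P (m + 1) = p \<and>
     (\<forall>i\<in>{1..m}. P i \<in> Pa Q I) \<and>
     (\<forall>i\<in>{1..m}. minimal_for Q I (P i) (P (i + 1))) \<and>
     (\<exists>j\<in>{1..m + 1}. minimal_for Q I (P j) (P 1))}"

definition GSt_lower_cp ::
    "('v, 'a) pre_digraph \<Rightarrow> (('v, 'a) qpath \<Rightarrow> 'k::field) set \<Rightarrow> ('v, 'a) gstring set \<Rightarrow> ('v, 'a) gstring set" where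
  "GSt_lower_cp Q I G = {Word w | w. Word w \<in> G \<and> min_height w = 0 \<and>
     (\<exists>p\<in>Pa_c Q I.
        (Word (Dir p # w) \<in> G \<and> (\<exists>v. w ! 0 = Dir v \<and> minimal_for Q I p v)) \<or>
        (\<exists>l u v. even l \<and> 0 < l \<and> l < length w \<and> height w l = 0 \<and>
           w ! (l - 1) = Inv u \<and> w ! l = Dir v \<and>
           path_class Q I p \<in> path_hom_kernel Q I u \<inter> path_hom_kernel Q I v \<and>
           minimal_for Q I p u \<and> minimal_for Q I p v))}"

definition GSt_upper_cp ::
    "('v, 'a) pre_digraph \<Rightarrow> (('v, 'a) qpath \<Rightarrow> 'k::field) set \<Rightarrow> ('v, 'a) gstring set \<Rightarrow> ('v, 'a) gstring set" where
  "GSt_upper_cp Q I G = {Word w | w. Word w \<in> G \<and> min_height w = height w (length w) \<and>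
     (\<exists>p\<in>Pa_c Q I. Word (w @ [Inv p]) \<in> G)}"


section \<open>The path algebra of a finite quiver is a ring\<close>

definition is_qpath_comp :: "('v, 'a) qpath \<Rightarrow> ('v, 'a) qpath \<Rightarrow> ('v, 'a) qpath \<Rightarrow> bool" where
  "is_qpath_comp x y r \<longleftrightarrow> snd (snd x) = fst y \<and> r = (fst x, fst (snd x) @ fst (snd y), snd (snd y))"

lemma path_algebra_mult_conv:
  "monoid.mult (path_algebra Q) f g r =
    (\<Sum>x\<in>{x. f x \<noteq> 0}. \<Sum>y\<in>{y. g y \<noteq> 0}. if is_qpath_comp x y r then f x * g y else (0::'k::field))"
  unfolding sum.cartesian_product
  by (simp add: path_algebra_def is_qpath_comp_def, rule sum.cong) (auto split: prod.splits)

lemma path_algebra_mult_superset: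
  assumes "finite X" "finite Y" "{x. f x \<noteq> 0} \<subseteq> X" "{y. g y \<noteq> 0} \<subseteq> Y"
  shows "monoid.mult (path_algebra Q) f g r =
    (\<Sum>x\<in>X. \<Sum>y\<in>Y. if is_qpath_comp x y r then f x * g y else (0::'k::field))"
proof -
  have "(\<Sum>y\<in>Y. if is_qpath_comp x y r then f x * g y else 0) = 
      (\<Sum>y\<in>{y. g y \<noteq> 0}. if is_qpath_comp x y r then f x * g y else 0)" for x
    using assms by (intro sum.mono_neutral_right) auto
  moreover have "(\<Sum>x\<in>X. \<Sum>y\<in>{y. g y \<noteq> 0}. if is_qpath_comp x y r then f x * g y else 0) =
     (\<Sum>x\<in>{x. f x \<noteq> 0}. \<Sum>y\<in>{y. g y \<noteq> 0}. if is_qpath_comp x y r then f x * g y else 0)"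
  proof (rule sum.mono_neutral_right)
    show "\<forall>x\<in>X - {x. f x \<noteq> 0}. (\<Sum>y\<in>{y. g y \<noteq> 0}. if is_qpath_comp x y r then f x * g y else 0) = 0"
      by (intro ballI sum.neutral) simp
  qed (use assms in auto)
  ultimately show ?thesis unfolding path_algebra_mult_conv by simp
qed

definition qpath_comp :: "('v, 'a) qpath \<Rightarrow> ('v, 'a) qpath \<Rightarrow> ('v, 'a) qpath" where
  "qpath_comp x y = (fst x, fst (snd x) @ fst (snd y), snd (snd y))"

lemma path_algebra_mult_support: "{r. monoid.mult (path_algebra Q) f g r \<noteq> (0::'k::field)} \<subseteq>
   (\<lambda>(x,y). qpath_comp x y) ` {(x,y). f x \<noteq> 0 \<and> g y \<noteq> 0 \<and> snd (snd x) = fst y}"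
proof
  fix r assume r: "r \<in> {r. monoid.mult (path_algebra Q) f g r \<noteq> (0::'k)}"
  have "\<exists>x\<in>{x. f x \<noteq> 0}. \<exists>y\<in>{y. g y \<noteq> 0}. (if is_qpath_comp x y r then f x * g y else (0::'k)) \<noteq> 0"
  proof (rule ccontr)
    assume "\<not> ?thesis"
    then have "monoid.mult (path_algebra Q) f g r = 0"
      unfolding path_algebra_mult_conv by (intro sum.neutral ballI) blast
    with r show False by simp
  qed
  then obtain x y where x: "f x \<noteq> 0" and y: "g y \<noteq> 0" "(if is_qpath_comp x y r then f x * g y else (0::'k)) \<noteq> 0"
    by blast
  hence "is_qpath_comp x y r" by (auto split: if_splits)
  with x y show "r \<in> (\<lambda>(x,y). qpath_comp x y) ` {(x,y). f x \<noteq> 0 \<and> g y \<noteq> 0 \<and> snd (snd x) = fst y}"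
    by (force simp: is_qpath_comp_def qpath_comp_def)
qed

lemma (in wf_digraph) path_algebra_mult_closed:
  assumes "f \<in> carrier (path_algebra G)" "g \<in> carrier (path_algebra G)"
  shows "monoid.mult (path_algebra G) f g \<in> carrier (path_algebra G :: (_ \<Rightarrow> 'k::field) ring)"
proof -
  have F: "finite {x. f x \<noteq> 0}" "finite {y. g y \<noteq> 0}" using assms unfolding path_algebra_def by simp_all
  have "finite ((\<lambda>(x,y). qpath_comp x y) ` {(x,y). f x \<noteq> 0 \<and> g y \<noteq> 0 \<and> snd (snd x) = fst y})"
    by (rule finite_imageI, rule finite_subset[OF _ finite_cartesian_product[OF F]]) blast
  hence 1: "finite {r. monoid.mult (path_algebra G) f g r \<noteq> 0}" by (rule finite_subset[OF path_algebra_mult_support])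
  have "qpath_comp x y \<in> qpaths G" if "f x \<noteq> 0" "g y \<noteq> 0" "snd (snd x) = fst y" for x y
  proof -
    have "x \<in> qpaths G" using assms(1) that(1) unfolding path_algebra_def by auto
    moreover have "y \<in> qpaths G" using assms(2) that(2) unfolding path_algebra_def by auto
    ultimately show ?thesis using that by (auto simp: qpaths_def qpath_comp_def)
  qed
  hence "(\<lambda>(x,y). qpath_comp x y) ` {(x,y). f x \<noteq> 0 \<and> g y \<noteq> 0 \<and> snd (snd x) = fst y} \<subseteq> qpaths G" by (auto simp del: split_paired_All)
  with path_algebra_mult_support have 2: "{r. monoid.mult (path_algebra G) f g r \<noteq> 0} \<subseteq> qpaths G" by (rule subset_trans)
  have "h \<in> carrier (path_algebra G)" if "finite {r. h r \<noteq> 0}" "{r. h r \<noteq> 0} \<subseteq> qpaths G" for h :: "_ \<Rightarrow> 'k"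
    using that by (simp add: path_algebra_def)
  from this[OF 1 2] show ?thesis .
qed

lemma sum_is_qpath_comp:
  assumes "finite S" "\<And>s. is_qpath_comp x y s \<Longrightarrow> s \<in> S"
  shows "(\<Sum>s\<in>S. if is_qpath_comp x y s then h s else (0::'k::field)) = (if snd (snd x) = fst y then h (qpath_comp x y) else 0)"
proof (cases "snd (snd x) = fst y")
  case True
  have "(\<Sum>s\<in>S. if is_qpath_comp x y s then h s else 0) = (\<Sum>s\<in>{qpath_comp x y}. if is_qpath_comp x y s then h s else 0)"
    using assms True by (intro sum.mono_neutral_right) (auto simp: is_qpath_comp_def qpath_comp_def)
  then show ?thesis using True by (auto simp: is_qpath_comp_def qpath_comp_def)
qed (auto simp: is_qpath_comp_def)

lemma qpath_comp_assoc:
  "(snd (snd x) = fst y \<and> is_qpath_comp (qpath_comp x y) z t) = (snd (snd y) = fst z \<and> is_qpath_comp x (qpath_comp y z) t)"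
  by (auto simp: is_qpath_comp_def qpath_comp_def)

lemma path_algebra_mult_assoc:
  assumes "f \<in> carrier (path_algebra G)" "g \<in> carrier (path_algebra G)" "h \<in> carrier (path_algebra G)"
  shows "monoid.mult (path_algebra G) (monoid.mult (path_algebra G) f g) h
    = monoid.mult (path_algebra G) f (monoid.mult (path_algebra G :: (_ \<Rightarrow> 'k::field) ring) g h)"
proof
  fix t
  define F where "F = {x. f x \<noteq> 0}"
  define G' where "G' = {x. g x \<noteq> 0}"
  define H where "H = {x. h x \<noteq> 0}"
  have fin: "finite F" "finite G'" "finite H" using assms unfolding path_algebra_def F_def G'_def H_def by simp_all
  define S where "S = (\<lambda>(x,y). qpath_comp x y) ` (F \<times> G')"
  define T where "T = (\<lambda>(x,y). qpath_comp x y) ` (G' \<times> H)"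
  have finS: "finite S" "finite T" using fin by (auto simp: S_def T_def)
  have Ssup: "{r. monoid.mult (path_algebra G) f g r \<noteq> 0} \<subseteq> S"
    using path_algebra_mult_support[of G f g] by (auto simp: S_def F_def G'_def)
  have Tsup: "{r. monoid.mult (path_algebra G) g h r \<noteq> 0} \<subseteq> T"
    using path_algebra_mult_support[of G g h] by (auto simp: T_def H_def G'_def)
  have SI: "is_qpath_comp x y s \<Longrightarrow> s \<in> S" if "x \<in> F" "y \<in> G'" for x y s
    using that by (force simp: S_def is_qpath_comp_def qpath_comp_def)
  have TI: "is_qpath_comp x y s \<Longrightarrow> s \<in> T" if "x \<in> G'" "y \<in> H" for x y s
    using that by (force simp: T_def is_qpath_comp_def qpath_comp_def)
  have "monoid.mult (path_algebra G) (monoid.mult (path_algebra G) f g) h t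
    = (\<Sum>s\<in>S. \<Sum>z\<in>H. if is_qpath_comp s z t then (\<Sum>x\<in>F. \<Sum>y\<in>G'. if is_qpath_comp x y s then f x * g y else 0) * h z else 0)"
  proof -
    have "monoid.mult (path_algebra G) (monoid.mult (path_algebra G) f g) h t
       = (\<Sum>s\<in>S. \<Sum>z\<in>H. if is_qpath_comp s z t then monoid.mult (path_algebra G) f g s * h z else 0)"
      by (rule path_algebra_mult_superset[OF finS(1) fin(3) Ssup]) (simp add: H_def)
    then show ?thesis unfolding path_algebra_mult_conv[of G f g] F_def[symmetric] G'_def[symmetric] .
  qed
  also have "\<dots> = (\<Sum>s\<in>S. \<Sum>z\<in>H. \<Sum>x\<in>F. \<Sum>y\<in>G'. if is_qpath_comp x y s then (if is_qpath_comp s z t then f x * g y * h z else 0) else 0)"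
    by (intro sum.cong refl) (simp add: sum_distrib_right if_distrib[of "\<lambda>u. u * _"] cong: if_cong)
  also have "\<dots> = (\<Sum>z\<in>H. \<Sum>x\<in>F. \<Sum>y\<in>G'. \<Sum>s\<in>S. if is_qpath_comp x y s then (if is_qpath_comp s z t then f x * g y * h z else 0) else 0)"
    by (subst sum.swap, rule sum.cong[OF refl], subst sum.swap, rule sum.cong[OF refl], subst sum.swap, rule refl)
  also have "\<dots> = (\<Sum>z\<in>H. \<Sum>x\<in>F. \<Sum>y\<in>G'. if snd (snd x) = fst y \<and> is_qpath_comp (qpath_comp x y) z t then f x * g y * h z else 0)"
    by (intro sum.cong refl) (subst sum_is_qpath_comp, use SI finS in auto)
  also have "\<dots> = (\<Sum>z\<in>H. \<Sum>x\<in>F. \<Sum>y\<in>G'. if snd (snd y) = fst z \<and> is_qpath_comp x (qpath_comp y z) t then f x * g y * h z else 0)"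
    by (simp only: qpath_comp_assoc)
  also have "\<dots> = (\<Sum>x\<in>F. \<Sum>y\<in>G'. \<Sum>z\<in>H. if snd (snd y) = fst z \<and> is_qpath_comp x (qpath_comp y z) t then f x * g y * h z else 0)"
    by (subst sum.swap, rule sum.cong[OF refl], subst sum.swap, rule refl)
  also have "\<dots> = (\<Sum>x\<in>F. \<Sum>y\<in>G'. \<Sum>z\<in>H. \<Sum>s\<in>T. if is_qpath_comp y z s then (if is_qpath_comp x s t then f x * g y * h z else 0) else 0)"
    by (intro sum.cong refl) (subst sum_is_qpath_comp, use TI finS in auto)
  also have "\<dots> = (\<Sum>x\<in>F. \<Sum>s\<in>T. \<Sum>y\<in>G'. \<Sum>z\<in>H. if is_qpath_comp y z s then (if is_qpath_comp x s t then f x * g y * h z else 0) else 0)"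
    by (rule sum.cong[OF refl], subst (2) sum.swap, rule sum.cong[OF refl], subst sum.swap, rule refl)
  also have "\<dots> = (\<Sum>x\<in>F. \<Sum>s\<in>T. if is_qpath_comp x s t then f x * (\<Sum>y\<in>G'. \<Sum>z\<in>H. if is_qpath_comp y z s then g y * h z else 0) else 0)"
    by (intro sum.cong refl) (simp add: sum_distrib_left mult.assoc if_distrib[of "\<lambda>u. _ * u"] cong: if_cong)
  also have "\<dots> = monoid.mult (path_algebra G) f (monoid.mult (path_algebra G) g h) t"
  proof -
    have "monoid.mult (path_algebra G) f (monoid.mult (path_algebra G) g h) t
       = (\<Sum>x\<in>F. \<Sum>s\<in>T. if is_qpath_comp x s t then f x * monoid.mult (path_algebra G) g h s else 0)"
      by (rule path_algebra_mult_superset[OF fin(1) finS(2) _ Tsup]) (simp add: F_def)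
    then show ?thesis unfolding path_algebra_mult_conv[of G g h] H_def[symmetric] G'_def[symmetric] by (rule sym)
  qed
  finally show "monoid.mult (path_algebra G) (monoid.mult (path_algebra G) f g) h t
    = monoid.mult (path_algebra G) f (monoid.mult (path_algebra G) g h) t" .
qed


lemma (in fin_digraph) ring_path_algebra: "ring (path_algebra G :: (('a, 'b) qpath \<Rightarrow> 'k::field) ring)"
proof -
  let ?R = "path_algebra G :: (('a, 'b) qpath \<Rightarrow> 'k::field) ring"
  have add: "f \<oplus>\<^bsub>?R\<^esub> g = (\<lambda>r. f r + g r)" for f g by (simp add: path_algebra_def)
  have zero: "\<zero>\<^bsub>?R\<^esub> = (\<lambda>r. 0)" by (simp add: path_algebra_def)
  have car: "f \<in> carrier ?R \<longleftrightarrow> finite {x. f x \<noteq> 0} \<and> {x. f x \<noteq> 0} \<subseteq> qpaths G" for f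
    by (simp add: path_algebra_def)
  define E :: "('a, 'b) qpath set" where "E = (\<lambda>v. (v, [], v)) ` verts G"
  have finE: "finite E" by (simp add: E_def)
  have one: "\<one>\<^bsub>?R\<^esub> = (\<lambda>r. if r \<in> E then 1 else 0)" by (auto simp: path_algebra_def E_def fun_eq_iff)
  have EQ: "E \<subseteq> qpaths G" by (auto simp: E_def qpaths_def awalk_def)
  have oneC: "\<one>\<^bsub>?R\<^esub> \<in> carrier ?R" unfolding car one using finE EQ by simp
  have endQ: "fst x \<in> verts G \<and> snd (snd x) \<in> verts G" if "x \<in> qpaths G" for x
    using that by (auto simp: qpaths_def)
  have addC: "f \<oplus>\<^bsub>?R\<^esub> g \<in> carrier ?R" if "f \<in> carrier ?R" "g \<in> carrier ?R" for f g
  proof -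
    have "{x. f x + g x \<noteq> 0} \<subseteq> {x. f x \<noteq> 0} \<union> {x. g x \<noteq> 0}" by auto
    then show ?thesis using that unfolding car add by (meson finite_UnI finite_subset subset_trans Un_least)
  qed
  show ?thesis
  proof (rule ringI)
    show "abelian_group ?R"
    proof (rule abelian_groupI)
      fix f assume f: "f \<in> carrier ?R"
      have "(\<lambda>r. - f r) \<in> carrier ?R" using f unfolding car by simp
      moreover have "(\<lambda>r. - f r) \<oplus>\<^bsub>?R\<^esub> f = \<zero>\<^bsub>?R\<^esub>" by (simp add: add zero)
      ultimately show "\<exists>y\<in>carrier ?R. y \<oplus>\<^bsub>?R\<^esub> f = \<zero>\<^bsub>?R\<^esub>" by blast
    next
      show "\<zero>\<^bsub>?R\<^esub> \<in> carrier ?R" by (simp add: car zero)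
    qed (use addC in \<open>auto simp: add zero fun_eq_iff algebra_simps\<close>)
  next
    show "Group.monoid ?R"
    proof (rule monoidI)
      fix f assume f: "f \<in> carrier ?R"
      have fin: "finite {x. f x \<noteq> 0}" and sub: "{x. f x \<noteq> 0} \<subseteq> qpaths G" using f by (simp_all add: car)
      have E1: "{x. \<one>\<^bsub>?R\<^esub> x \<noteq> 0} \<subseteq> E" by (auto simp: one)
      show "\<one>\<^bsub>?R\<^esub> \<otimes>\<^bsub>?R\<^esub> f = f"
      proof
        fix r
        have "(\<one>\<^bsub>?R\<^esub> \<otimes>\<^bsub>?R\<^esub> f) r = (\<Sum>x\<in>E. \<Sum>y\<in>{y. f y \<noteq> 0}. if is_qpath_comp x y r then \<one>\<^bsub>?R\<^esub> x * f y else 0)"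
          by (rule path_algebra_mult_superset[OF finE fin E1 order_refl])
        also have "\<dots> = (\<Sum>y\<in>{y. f y \<noteq> 0}. \<Sum>x\<in>E. if is_qpath_comp x y r then \<one>\<^bsub>?R\<^esub> x * f y else 0)"
          by (rule sum.swap)
        also have "\<dots> = (\<Sum>y\<in>{y. f y \<noteq> 0}. if y = r then f r else 0)"
        proof (rule sum.cong[OF refl])
          fix y assume "y \<in> {y. f y \<noteq> 0}"
          then have v: "fst y \<in> verts G" using sub endQ by blast
          have "(\<Sum>x\<in>E. if is_qpath_comp x y r then \<one>\<^bsub>?R\<^esub> x * f y else 0) = (\<Sum>x\<in>{(fst y, [], fst y)}. if is_qpath_comp x y r then \<one>\<^bsub>?R\<^esub> x * f y else 0)"
            by (rule sum.mono_neutral_right) (use finE v in \<open>auto simp: E_def is_qpath_comp_def\<close>)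
          also have "\<dots> = (if y = r then f r else 0)" using v by (auto simp: one E_def is_qpath_comp_def)
          finally show "(\<Sum>x\<in>E. if is_qpath_comp x y r then \<one>\<^bsub>?R\<^esub> x * f y else 0) = (if y = r then f r else 0)" .
        qed
        also have "\<dots> = f r" using fin by (simp add: sum.delta)
        finally show "(\<one>\<^bsub>?R\<^esub> \<otimes>\<^bsub>?R\<^esub> f) r = f r" .
      qed
      show "f \<otimes>\<^bsub>?R\<^esub> \<one>\<^bsub>?R\<^esub> = f"
      proof
        fix r
        have "(f \<otimes>\<^bsub>?R\<^esub> \<one>\<^bsub>?R\<^esub>) r = (\<Sum>y\<in>{y. f y \<noteq> 0}. \<Sum>x\<in>E. if is_qpath_comp y x r then f y * \<one>\<^bsub>?R\<^esub> x else 0)"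
          by (rule path_algebra_mult_superset[OF fin finE order_refl E1])
        also have "\<dots> = (\<Sum>y\<in>{y. f y \<noteq> 0}. if y = r then f r else 0)"
        proof (rule sum.cong[OF refl])
          fix y assume "y \<in> {y. f y \<noteq> 0}"
          then have v: "snd (snd y) \<in> verts G" using sub endQ by blast
          have "(\<Sum>x\<in>E. if is_qpath_comp y x r then f y * \<one>\<^bsub>?R\<^esub> x else 0) = (\<Sum>x\<in>{(snd (snd y), [], snd (snd y))}. if is_qpath_comp y x r then f y * \<one>\<^bsub>?R\<^esub> x else 0)"
            by (rule sum.mono_neutral_right) (use finE v in \<open>auto simp: E_def is_qpath_comp_def\<close>)
          also have "\<dots> = (if y = r then f r else 0)" using v by (auto simp: one E_def is_qpath_comp_def)
          finally show "(\<Sum>x\<in>E. if is_qpath_comp y x r then f y * \<one>\<^bsub>?R\<^esub> x else 0) = (if y = r then f r else 0)" .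
        qed
        also have "\<dots> = f r" using fin by (simp add: sum.delta)
        finally show "(f \<otimes>\<^bsub>?R\<^esub> \<one>\<^bsub>?R\<^esub>) r = f r" .
      qed
    qed (use oneC path_algebra_mult_closed path_algebra_mult_assoc in blast)+
  next
    fix f g h assume c: "f \<in> carrier ?R" "g \<in> carrier ?R" "h \<in> carrier ?R"
    define X where "X = {x. f x \<noteq> 0} \<union> {x. g x \<noteq> 0} \<union> {x. h x \<noteq> 0}"
    have X: "finite X" "{x. f x \<noteq> 0} \<subseteq> X" "{x. g x \<noteq> 0} \<subseteq> X" "{x. h x \<noteq> 0} \<subseteq> X"
      using c unfolding car X_def by auto
    have s: "{x. (f \<oplus>\<^bsub>?R\<^esub> g) x \<noteq> 0} \<subseteq> X" by (auto simp: add X_def)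
    have *: "(if b then u + v else 0) = (if b then u else 0) + (if b then v else (0::'k))" for b u v by simp
    show "(f \<oplus>\<^bsub>?R\<^esub> g) \<otimes>\<^bsub>?R\<^esub> h = f \<otimes>\<^bsub>?R\<^esub> h \<oplus>\<^bsub>?R\<^esub> g \<otimes>\<^bsub>?R\<^esub> h"
    proof
      fix r show "((f \<oplus>\<^bsub>?R\<^esub> g) \<otimes>\<^bsub>?R\<^esub> h) r = (f \<otimes>\<^bsub>?R\<^esub> h \<oplus>\<^bsub>?R\<^esub> g \<otimes>\<^bsub>?R\<^esub> h) r"
        unfolding add[of "f \<otimes>\<^bsub>?R\<^esub> h"] path_algebra_mult_superset[OF X(1) X(1) s X(4)] path_algebra_mult_superset[OF X(1) X(1) X(2) X(4)]
          path_algebra_mult_superset[OF X(1) X(1) X(3) X(4)]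
        by (simp only: add distrib_right * sum.distrib)
    qed
    show "h \<otimes>\<^bsub>?R\<^esub> (f \<oplus>\<^bsub>?R\<^esub> g) = h \<otimes>\<^bsub>?R\<^esub> f \<oplus>\<^bsub>?R\<^esub> h \<otimes>\<^bsub>?R\<^esub> g"
    proof
      fix r show "(h \<otimes>\<^bsub>?R\<^esub> (f \<oplus>\<^bsub>?R\<^esub> g)) r = (h \<otimes>\<^bsub>?R\<^esub> f \<oplus>\<^bsub>?R\<^esub> h \<otimes>\<^bsub>?R\<^esub> g) r"
        unfolding add[of "h \<otimes>\<^bsub>?R\<^esub> f"] path_algebra_mult_superset[OF X(1) X(1) X(4) s] path_algebra_mult_superset[OF X(1) X(1) X(4) X(2)]
          path_algebra_mult_superset[OF X(1) X(1) X(4) X(3)]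
        by (simp only: add distrib_left * sum.distrib)
    qed
  qed
qed

end

theory Submission
  imports Defs
begin

text \<open>
  Any cycle of minimal zero relations already forces infinite global dimension, so it suffices that
  \<^const>\<open>Pa_c\<close> is non-empty. Let \<open>c\<^sub>0, c\<^sub>1, \<dots>\<close> run around such a cycle against its direction, so that
  \<open>c\<^sub>n\<^sub>+\<^sub>1\<close> is minimal for \<open>c\<^sub>n\<close>. Right multiplication by \<open>c\<^sub>n\<close> maps \<open>A\<close> onto \<open>A c\<^sub>n\<close>, and since \<open>I\<close> is
  monomial, its kernel is spanned by paths; discarding the paths that do not end in \<open>c\<^sub>n\<^sub>+\<^sub>1\<close> is
  \<open>A\<close>-linear there by minimality, so \<open>A c\<^sub>n\<^sub>+\<^sub>1\<close> is a direct summand of the kernel. Moreover no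
  \<open>A c\<^sub>n\<close> is projective: a splitting would give \<open>y\<close> with \<open>y c\<^sub>n = c\<^sub>n\<close> and \<open>c\<^sub>n\<^sub>+\<^sub>1 y = 0\<close>, but the
  first equation makes the coefficient of \<open>y\<close> at the trivial path equal to \<open>1\<close> and the second makes
  it \<open>0\<close>. By induction on \<open>n\<close>, no \<open>A c\<^sub>i\<close> has a projective resolution of length \<open>n\<close>.
\<close>

section \<open>Left modules and projective resolutions\<close>

lemma (in left_module) smult_zero_left:
  assumes "x \<in> carrier M"
  shows "\<zero>\<^bsub>R\<^esub> \<odot>\<^bsub>M\<^esub> x = \<zero>\<^bsub>M\<^esub>"
proof -
  have "\<zero>\<^bsub>R\<^esub> \<odot>\<^bsub>M\<^esub> x \<oplus>\<^bsub>M\<^esub> \<zero>\<^bsub>R\<^esub> \<odot>\<^bsub>M\<^esub> x = \<zero>\<^bsub>R\<^esub> \<odot>\<^bsub>M\<^esub> x"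
    using smult_l_distr[of "\<zero>\<^bsub>R\<^esub>" "\<zero>\<^bsub>R\<^esub>" x] assms by simp
  then show ?thesis
    using assms smult_closed[of "\<zero>\<^bsub>R\<^esub>" x] by (metis R.zero_closed M.add.r_cancel_one)
qed

lemma module_homD:
  assumes "f \<in> module_hom R M N"
  shows "x \<in> carrier M \<Longrightarrow> f x \<in> carrier N"
    and "x \<in> carrier M \<Longrightarrow> y \<in> carrier M \<Longrightarrow> f (x \<oplus>\<^bsub>M\<^esub> y) = f x \<oplus>\<^bsub>N\<^esub> f y"
    and "a \<in> carrier R \<Longrightarrow> x \<in> carrier M \<Longrightarrow> f (a \<odot>\<^bsub>M\<^esub> x) = a \<odot>\<^bsub>N\<^esub> f x"
  using assms by (auto simp: module_hom_def)

lemma module_homI: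
  assumes "\<And>x. x \<in> carrier M \<Longrightarrow> f x \<in> carrier N"
    and "\<And>x y. x \<in> carrier M \<Longrightarrow> y \<in> carrier M \<Longrightarrow> f (x \<oplus>\<^bsub>M\<^esub> y) = f x \<oplus>\<^bsub>N\<^esub> f y"
    and "\<And>a x. a \<in> carrier R \<Longrightarrow> x \<in> carrier M \<Longrightarrow> f (a \<odot>\<^bsub>M\<^esub> x) = a \<odot>\<^bsub>N\<^esub> f x"
  shows "f \<in> module_hom R M N"
  using assms by (auto simp: module_hom_def)

lemma module_hom_compose:
  assumes "f \<in> module_hom R L M" "g \<in> module_hom R M N"
  shows "(\<lambda>x. g (f x)) \<in> module_hom R L N"
  by (rule module_homI) (simp_all add: module_homD[OF assms(1)] module_homD[OF assms(2)])

lemma module_hom_zero: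
  assumes "left_module R M" "left_module R N" "f \<in> module_hom R M N"
  shows "f \<zero>\<^bsub>M\<^esub> = \<zero>\<^bsub>N\<^esub>"
proof -
  interpret M: left_module R M by fact
  interpret N: left_module R N by fact
  have "f \<zero>\<^bsub>M\<^esub> = f (\<zero>\<^bsub>R\<^esub> \<odot>\<^bsub>M\<^esub> \<zero>\<^bsub>M\<^esub>)"
    by (simp add: M.smult_zero_left)
  also have "\<dots> = \<zero>\<^bsub>R\<^esub> \<odot>\<^bsub>N\<^esub> f \<zero>\<^bsub>M\<^esub>"
    by (simp add: module_homD[OF assms(3)])
  also have "\<dots> = \<zero>\<^bsub>N\<^esub>"
    by (rule N.smult_zero_left) (simp add: module_homD[OF assms(3)])
  finally show ?thesis .
qed

lemma left_module_kernel:
  assumes "left_module R M" "left_module R N" "f \<in> module_hom R M N"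
  shows "left_module R (M\<lparr>carrier := a_kernel M N f\<rparr>)"
proof -
  interpret M: left_module R M by fact
  interpret N: left_module R N by fact
  note f = module_homD[OF assms(3)]
  have f0: "f \<zero>\<^bsub>M\<^esub> = \<zero>\<^bsub>N\<^esub>" by (rule module_hom_zero[OF assms])
  have N0: "a \<odot>\<^bsub>N\<^esub> \<zero>\<^bsub>N\<^esub> = \<zero>\<^bsub>N\<^esub>" if "a \<in> carrier R" for a
    using that N.smult_assoc[of a "\<zero>\<^bsub>R\<^esub>" "\<zero>\<^bsub>N\<^esub>"] by (simp add: N.smult_zero_left)
  have inv: "\<exists>y\<in>a_kernel M N f. y \<oplus>\<^bsub>M\<^esub> x = \<zero>\<^bsub>M\<^esub>" if "x \<in> a_kernel M N f" for x
  proof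
    \<comment> \<open>The negative of x is taken as (-1) x, so that its membership in the kernel
      follows from linearity of \<open>f\<close> and from a 0 = 0 in N.\<close>
    let ?m = "\<ominus>\<^bsub>R\<^esub> \<one>\<^bsub>R\<^esub>"
    have x: "x \<in> carrier M" "f x = \<zero>\<^bsub>N\<^esub>" using that by (auto simp: a_kernel_def')
    have "(?m \<oplus>\<^bsub>R\<^esub> \<one>\<^bsub>R\<^esub>) \<odot>\<^bsub>M\<^esub> x = ?m \<odot>\<^bsub>M\<^esub> x \<oplus>\<^bsub>M\<^esub> \<one>\<^bsub>R\<^esub> \<odot>\<^bsub>M\<^esub> x"
      by (rule M.smult_l_distr) (use x in simp_all)
    then show "?m \<odot>\<^bsub>M\<^esub> x \<oplus>\<^bsub>M\<^esub> x = \<zero>\<^bsub>M\<^esub>"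
      using x by (simp add: M.R.l_neg M.smult_zero_left M.smult_one)
    show "?m \<odot>\<^bsub>M\<^esub> x \<in> a_kernel M N f"
      using x by (simp add: a_kernel_def' M.smult_closed f N0)
  qed
  show ?thesis
  proof (intro left_module.intro left_module_axioms.intro)
    show "ring R" by (rule M.R.ring_axioms)
    show "abelian_group (M\<lparr>carrier := a_kernel M N f\<rparr>)"
      by (rule abelian_groupI)
        (use inv in \<open>auto simp: a_kernel_def' f f0 M.M.a_ac\<close>)
  qed (auto simp: a_kernel_def' f N0 M.smult_closed M.smult_l_distr M.smult_r_distr M.smult_assoc M.smult_one)
qed

text \<open>If a submodule L of N contains the images of the generators, its preimage is a submodule
  of P containing the generators, hence all of P, and L is everything. Applied to
  \<open>d 0\<close>, this makes syzygies finitely generated.\<close>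

lemma fg_left_module_image:
  assumes P: "fg_left_module R P" and N: "left_module R N"
    and f: "f \<in> module_hom R P N" "f ` carrier P = carrier N"
  shows "fg_left_module R N"
proof -
  interpret P: left_module R P using P by (simp add: fg_left_module_def)
  interpret N: left_module R N by fact
  note f' = module_homD[OF f(1)]
  obtain S where S: "finite S" "S \<subseteq> carrier P"
    "\<And>L. submodule L R P \<Longrightarrow> S \<subseteq> L \<Longrightarrow> L = carrier P"
    using P by (auto simp: fg_left_module_def)
  have "L = carrier N" if L: "submodule L R N" "f ` S \<subseteq> L" for L
  proof -
    interpret L: submodule L R N by fact
    have sub: "L \<subseteq> carrier N" using L.subset by simp
    let ?K = "{x \<in> carrier P. f x \<in> L}"
    have f0: "f \<zero>\<^bsub>P\<^esub> = \<zero>\<^bsub>N\<^esub>"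
      by (rule module_hom_zero) (unfold_locales, rule f)
    have "submodule ?K R P"
    proof (intro submodule.intro submodule_axioms.intro subgroup.intro)
      fix x assume "x \<in> ?K"
      then have x: "x \<in> carrier P" "f x \<in> L" by auto
      \<comment> \<open>Submodules are subgroups of \<open>add_monoid\<close>, so negatives appear
        here as group inverses and are translated to \<open>a_inv\<close> by hand.\<close>
      let ?y = "inv\<^bsub>add_monoid P\<^esub> x"
      have y: "?y \<in> carrier P" "?y \<oplus>\<^bsub>P\<^esub> x = \<zero>\<^bsub>P\<^esub>"
        using x P.M.add.inv_closed P.M.add.l_inv by auto
      then have "f ?y \<oplus>\<^bsub>N\<^esub> f x = \<zero>\<^bsub>N\<^esub>"
        using x f'(2)[of ?y x] f0 by simp
      then have "\<ominus>\<^bsub>N\<^esub> f x = f ?y"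
        using x y f'(1) by (intro N.M.minus_equality) auto
      then have "f ?y = inv\<^bsub>add_monoid N\<^esub> (f x)" by (simp add: a_inv_def)
      moreover have "inv\<^bsub>add_monoid N\<^esub> (f x) \<in> L" using L.m_inv_closed[of "f x"] x by simp
      ultimately show "?y \<in> ?K" using y by simp
    qed (use f' f0 L.m_closed L.one_closed L.smult_closed P.smult_closed in auto)
    moreover have "S \<subseteq> ?K" using S(2) L(2) by auto
    ultimately have "?K = carrier P" by (rule S(3))
    then have "f ` carrier P \<subseteq> L" by auto
    then show ?thesis using f(2) sub by auto
  qed
  moreover have "f ` S \<subseteq> carrier N" using S(2) f'(1) by auto
  ultimately show ?thesis
    unfolding fg_left_module_def using N S(1) by (meson finite_imageI)
qed

lemma has_projective_resolutionE:
  assumes "has_projective_resolution R M n"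
  obtains P e d where "\<And>i. projective_module R (P i)" "\<And>i. i > n \<Longrightarrow> carrier (P i) = {\<zero>\<^bsub>P i\<^esub>}"
    "e \<in> module_hom R (P 0) M" "e ` carrier (P 0) = carrier M"
    "\<And>i. d i \<in> module_hom R (P (Suc i)) (P i)" "d 0 ` carrier (P 1) = a_kernel (P 0) M e"
    "\<And>i. d (Suc i) ` carrier (P (Suc (Suc i))) = a_kernel (P (Suc i)) (P i) (d i)"
proof -
  obtain P d e where *: "(\<forall>i. projective_module R (P i)) \<and>
     (\<forall>i>n. carrier (P i) = {\<zero>\<^bsub>P i\<^esub>}) \<and> e \<in> module_hom R (P 0) M \<and>
     (\<forall>i. d i \<in> module_hom R (P (Suc i)) (P i)) \<and> e ` carrier (P 0) = carrier M \<and>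
     d 0 ` carrier (P 1) = a_kernel (P 0) M e \<and>
     (\<forall>i. d (Suc i) ` carrier (P (Suc (Suc i))) = a_kernel (P (Suc i)) (P i) (d i))"
    using assms unfolding has_projective_resolution_def by (elim exE)
  show ?thesis by (rule that[of P e d]) (use * in simp_all)
qed

section \<open>Left ideals generated by one element\<close>

text \<open>The left ideal \<open>R c\<close>; the ring element \<open>x\<close> is encoded as the constant sequence \<open>\<lambda>_. x\<close>.\<close>

definition cyclic_module :: "'r ring \<Rightarrow> 'r \<Rightarrow> 'r lmod" where
  "cyclic_module R c =
    \<lparr>carrier = {\<lambda>_. x \<otimes>\<^bsub>R\<^esub> c | x. x \<in> carrier R},
     monoid.mult = (\<lambda>f g. f), one = (\<lambda>_. \<zero>\<^bsub>R\<^esub>), zero = (\<lambda>_. \<zero>\<^bsub>R\<^esub>),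
     add = (\<lambda>f g i. f i \<oplus>\<^bsub>R\<^esub> g i), module.smult = (\<lambda>a f i. a \<otimes>\<^bsub>R\<^esub> f i)\<rparr>"

lemma cyclic_module_simps [simp]:
  "\<zero>\<^bsub>cyclic_module R c\<^esub> = (\<lambda>_. \<zero>\<^bsub>R\<^esub>)"
  "f \<oplus>\<^bsub>cyclic_module R c\<^esub> g = (\<lambda>i. f i \<oplus>\<^bsub>R\<^esub> g i)"
  "a \<odot>\<^bsub>cyclic_module R c\<^esub> f = (\<lambda>i. a \<otimes>\<^bsub>R\<^esub> f i)"
  by (simp_all add: cyclic_module_def)

lemma cyclic_module_carrier:
  "v \<in> carrier (cyclic_module R c) \<longleftrightarrow> (\<exists>x\<in>carrier R. v = (\<lambda>_. x \<otimes>\<^bsub>R\<^esub> c))"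
  by (auto simp: cyclic_module_def)

text \<open>Modules, homomorphisms and resolutions are defined over the bare record type
  \<open>'r ring\<close>, whereas the locale \<open>ring\<close> admits record extensions.\<close>

locale plain_ring = ring R for R :: "'r ring" (structure)

text \<open>For c = 1 the left ideal is R itself. It serves as the free module of rank one, and
  \<open>v 0\<close> recovers the ring element from its encoding.\<close>

lemma (in plain_ring) cyclic_module_one_carrier:
  "v \<in> carrier (cyclic_module R \<one>) \<longleftrightarrow> v 0 \<in> carrier R \<and> (\<lambda>_. v 0) = v"
  by (auto simp: cyclic_module_carrier intro!: bexI[of _ "v 0"])

lemma (in plain_ring) cyclic_module_one_coeff:
  "v \<in> carrier (cyclic_module R \<one>) \<Longrightarrow> v 0 \<in> carrier R"
  by (simp add: cyclic_module_one_carrier)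

lemma (in plain_ring) left_module_cyclic:
  assumes c: "c \<in> carrier R"
  shows "left_module R (cyclic_module R c)"
proof (intro left_module.intro left_module_axioms.intro)
  show "ring R" by (rule ring_axioms)
  show "abelian_group (cyclic_module R c)"
  proof (rule abelian_groupI)
    fix v w assume "v \<in> carrier (cyclic_module R c)" "w \<in> carrier (cyclic_module R c)"
    then obtain x y where "x \<in> carrier R" "y \<in> carrier R" "v = (\<lambda>_. x \<otimes> c)" "w = (\<lambda>_. y \<otimes> c)"
      by (auto simp: cyclic_module_carrier)
    then show "v \<oplus>\<^bsub>cyclic_module R c\<^esub> w \<in> carrier (cyclic_module R c)"
      using c by (auto simp: cyclic_module_carrier intro!: bexI[of _ "x \<oplus> y"] simp: l_distr)
  next
    show "\<zero>\<^bsub>cyclic_module R c\<^esub> \<in> carrier (cyclic_module R c)"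
      using c by (auto simp: cyclic_module_carrier intro!: bexI[of _ \<zero>])
  next
    fix v assume "v \<in> carrier (cyclic_module R c)"
    then obtain x where x: "x \<in> carrier R" "v = (\<lambda>_. x \<otimes> c)"
      by (auto simp: cyclic_module_carrier)
    have "(\<ominus> x) \<otimes> c \<oplus> x \<otimes> c = \<zero>" using x c by (simp add: l_minus l_neg)
    then show "\<exists>w\<in>carrier (cyclic_module R c). w \<oplus>\<^bsub>cyclic_module R c\<^esub> v = \<zero>\<^bsub>cyclic_module R c\<^esub>"
      using x by (intro bexI[of _ "\<lambda>_. (\<ominus> x) \<otimes> c"]) (auto simp: cyclic_module_carrier)
  qed (use c in \<open>auto simp: cyclic_module_carrier a_ac\<close>)
next
  fix a v assume "a \<in> carrier R" "v \<in> carrier (cyclic_module R c)"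
  then obtain x where "a \<in> carrier R" "x \<in> carrier R" "v = (\<lambda>_. x \<otimes> c)"
    by (auto simp: cyclic_module_carrier)
  then show "a \<odot>\<^bsub>cyclic_module R c\<^esub> v \<in> carrier (cyclic_module R c)"
    using c by (auto simp: cyclic_module_carrier m_assoc intro!: bexI[of _ "a \<otimes> x"])
qed (use c in \<open>auto simp: cyclic_module_carrier l_distr r_distr m_assoc\<close>)

lemma (in plain_ring) fg_left_module_cyclic:
  assumes c: "c \<in> carrier R"
  shows "fg_left_module R (cyclic_module R c)"
proof -
  have "N = carrier (cyclic_module R c)"
    if N: "submodule N R (cyclic_module R c)" "{\<lambda>_. c} \<subseteq> N" for N
  proof -
    interpret submodule N R "cyclic_module R c" by fact
    have "N \<subseteq> carrier (cyclic_module R c)" using subset by simp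
    moreover have "(\<lambda>_. x \<otimes> c) \<in> N" if "x \<in> carrier R" for x
      using smult_closed[of x "\<lambda>_. c"] N(2) that by simp
    ultimately show ?thesis by (auto simp: cyclic_module_carrier)
  qed
  moreover have "(\<lambda>_. c) \<in> carrier (cyclic_module R c)"
    using c by (auto simp: cyclic_module_carrier intro!: bexI[of _ \<one>])
  ultimately show ?thesis
    unfolding fg_left_module_def using left_module_cyclic[OF c]
    by (auto intro!: exI[of _ "{\<lambda>_. c}"])
qed

text \<open>A map out of the free module is determined by its value at 1: choose a preimage m of
  f(1) under \<open>g\<close> and send v to v m.\<close>

lemma (in plain_ring) projective_cyclic_one: "projective_module R (cyclic_module R \<one>)"
  unfolding projective_module_def
proof (intro conjI allI impI, goal_cases)
  case 1
  show ?case by (rule fg_left_module_cyclic) simp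
next
  case (2 M N g f)
  then have g: "g \<in> module_hom R M N" "g ` carrier M = carrier N"
    and f: "f \<in> module_hom R (cyclic_module R \<one>) N" and M: "left_module R M"
    by (auto simp: fg_left_module_def)
  interpret M: left_module R M by fact
  have 1: "(\<lambda>_. \<one>) \<in> carrier (cyclic_module R \<one>)"
    by (simp add: cyclic_module_one_carrier)
  have "f (\<lambda>_. \<one>) \<in> g ` carrier M"
    using g(2) module_homD(1)[OF f 1] by simp
  then obtain m where m: "m \<in> carrier M" "g m = f (\<lambda>_. \<one>)" by auto
  let ?h = "\<lambda>v. v 0 \<odot>\<^bsub>M\<^esub> m"
  have "?h \<in> module_hom R (cyclic_module R \<one>) M"
    by (rule module_homI)
      (use m in \<open>simp_all add: cyclic_module_one_coeff M.smult_closed M.smult_l_distr M.smult_assoc\<close>)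
  moreover have "g (?h v) = f v" if "v \<in> carrier (cyclic_module R \<one>)" for v
  proof -
    have v: "v 0 \<in> carrier R" "(\<lambda>_. v 0) = v"
      using that by (auto simp: cyclic_module_one_carrier)
    have "g (?h v) = v 0 \<odot>\<^bsub>N\<^esub> f (\<lambda>_. \<one>)"
      using v m by (simp add: module_homD(3)[OF g(1)])
    also have "\<dots> = f (\<lambda>_. v 0 \<otimes> \<one>)"
      using module_homD(3)[OF f v(1) 1] by simp
    also have "(\<lambda>_. v 0 \<otimes> \<one>) = v" using v by simp
    finally show ?thesis .
  qed
  ultimately show ?case by (intro bexI[of _ ?h] ballI)
qed

section \<open>Retracts up to maps through projectives\<close>

text \<open>The identity of \<open>C\<close> factors through \<open>X\<close> up to a map that factors through a projective module.
  Unlike being a direct summand, this notion passes to syzygies without adding free summands.\<close>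

definition stable_retract :: "'r ring \<Rightarrow> 'r lmod \<Rightarrow> 'r lmod \<Rightarrow> bool" where
  "stable_retract R C X \<longleftrightarrow> (\<exists>F \<alpha> \<beta> f g. projective_module R F \<and>
     \<alpha> \<in> module_hom R C F \<and> \<beta> \<in> module_hom R F C \<and> f \<in> module_hom R C X \<and> g \<in> module_hom R X C \<and>
     (\<forall>x\<in>carrier C. x = g (f x) \<oplus>\<^bsub>C\<^esub> \<beta> (\<alpha> x)))"

lemma projective_lift:
  assumes "projective_module R P" "fg_left_module R M" "fg_left_module R N"
    "g \<in> module_hom R M N" "g ` carrier M = carrier N" "f \<in> module_hom R P N"
  obtains h where "h \<in> module_hom R P M" "\<And>x. x \<in> carrier P \<Longrightarrow> g (h x) = f x"
  using assms unfolding projective_module_def by metis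

text \<open>Lifting the retraction data along the surjections R -> R c and \<open>e\<close> gives
  two endomorphisms of R whose sum is right multiplication by some y with y c = c. The one through
  the auxiliary projective module factors through R -> R c, so it vanishes on the syzygy of all x
  with x c = 0. There, multiplication by y factors through the kernel of \<open>e\<close>.\<close>

lemma (in plain_ring) stable_retract_lift:
  assumes c: "c \<in> carrier R"
    and X: "fg_left_module R X" and P: "projective_module R P"
    and e: "e \<in> module_hom R P X" "e ` carrier P = carrier X"
    and retract: "stable_retract R (cyclic_module R c) X"
  obtains f g y where
    "f \<in> module_hom R (cyclic_module R \<one>) P" "g \<in> module_hom R P (cyclic_module R \<one>)"
    "y \<in> carrier R"
    "\<And>v. v \<in> carrier P \<Longrightarrow> e v = \<zero>\<^bsub>X\<^esub> \<Longrightarrow> g v 0 \<otimes> c = \<zero>"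
    "\<And>x. x \<in> carrier R \<Longrightarrow> x \<otimes> c = \<zero> \<Longrightarrow> e (f (\<lambda>_. x)) = \<zero>\<^bsub>X\<^esub>"
    "y \<otimes> c = c"
    "\<And>x. x \<in> carrier R \<Longrightarrow> x \<otimes> c = \<zero> \<Longrightarrow> x \<otimes> y = g (f (\<lambda>_. x)) 0"
proof -
  let ?E = "cyclic_module R \<one>" and ?C = "cyclic_module R c"
  let ?\<pi> = "\<lambda>v i. v i \<otimes> c"
  have E: "projective_module R ?E" by (rule projective_cyclic_one)
  have fgE: "fg_left_module R ?E" and fgC: "fg_left_module R ?C" and fgP: "fg_left_module R P"
    using c P by (simp_all add: fg_left_module_cyclic projective_module_def)
  have \<pi>: "?\<pi> \<in> module_hom R ?E ?C"
    by (rule module_homI)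
      (use c in \<open>auto simp: cyclic_module_carrier m_assoc l_distr\<close>)
  have sur: "?\<pi> ` carrier ?E = carrier ?C"
  proof
    show "?\<pi> ` carrier ?E \<subseteq> carrier ?C" using module_homD(1)[OF \<pi>] by auto
    show "carrier ?C \<subseteq> ?\<pi> ` carrier ?E"
      by (auto simp: cyclic_module_carrier[where c = c] cyclic_module_one_carrier image_iff
          intro!: bexI[of _ "\<lambda>_. _"])
  qed
  obtain F \<alpha> \<beta> f g where F: "projective_module R F" and \<alpha>: "\<alpha> \<in> module_hom R ?C F"
    and \<beta>: "\<beta> \<in> module_hom R F ?C" and f: "f \<in> module_hom R ?C X" and g: "g \<in> module_hom R X ?C"
    and id: "\<And>x. x \<in> carrier ?C \<Longrightarrow> x = g (f x) \<oplus>\<^bsub>?C\<^esub> \<beta> (\<alpha> x)"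
    using retract unfolding stable_retract_def by blast
  obtain f0 where f0: "f0 \<in> module_hom R ?E P" "\<And>x. x \<in> carrier ?E \<Longrightarrow> e (f0 x) = f (?\<pi> x)"
    using projective_lift[OF E fgP X e module_hom_compose[OF \<pi> f]] by blast
  obtain g0 where g0: "g0 \<in> module_hom R P ?E" "\<And>x. x \<in> carrier P \<Longrightarrow> ?\<pi> (g0 x) = g (e x)"
    using projective_lift[OF P fgE fgC \<pi> sur module_hom_compose[OF e(1) g]] by blast
  obtain b where b: "b \<in> module_hom R F ?E" "\<And>x. x \<in> carrier F \<Longrightarrow> ?\<pi> (b x) = \<beta> x"
    using projective_lift[OF F fgE fgC \<pi> sur \<beta>] by blast
  have lm: "left_module R X" "left_module R P" "left_module R F" "left_module R ?E" "left_module R ?C"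
    using X fgP fgE fgC F by (auto simp: fg_left_module_def projective_module_def)
  \<comment> \<open>\<open>?s\<close> lifts g f and \<open>?t\<close> lifts \<beta> \<alpha>, so
    their sum lifts the identity of R c.\<close>
  let ?s = "\<lambda>v. g0 (f0 v)" and ?t = "\<lambda>v. b (\<alpha> (?\<pi> v))"
  have s: "?s \<in> module_hom R ?E ?E" by (rule module_hom_compose[OF f0(1) g0(1)])
  have t: "?t \<in> module_hom R ?E ?E"
    by (rule module_hom_compose[OF module_hom_compose[OF \<pi> \<alpha>] b(1)])
  have 1: "(\<lambda>_. \<one>) \<in> carrier ?E" by (simp add: cyclic_module_one_carrier)
  \<comment> \<open>An endomorphism of the free module of rank one is right multiplication by its
    value at 1.\<close>
  have val: "h v 0 = v 0 \<otimes> h (\<lambda>_. \<one>) 0" if "h \<in> module_hom R ?E ?E" "v \<in> carrier ?E" for h v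
  proof -
    have v: "v 0 \<in> carrier R" "(\<lambda>_. v 0) = v" using that by (simp_all add: cyclic_module_one_carrier)
    then show ?thesis
      using fun_cong[OF module_homD(3)[OF that(1) v(1) 1], of 0] by simp
  qed
  let ?s1 = "?s (\<lambda>_. \<one>) 0" and ?t1 = "?t (\<lambda>_. \<one>) 0"
  have st: "?s1 \<in> carrier R" "?t1 \<in> carrier R"
    using module_homD(1)[OF s 1] module_homD(1)[OF t 1] by (auto dest!: cyclic_module_one_coeff)
  have cst: "(\<lambda>_. x) \<in> carrier ?E" if "x \<in> carrier R" for x
    using that by (simp add: cyclic_module_one_carrier)
  show ?thesis
  proof (rule that[OF f0(1) g0(1), of "?s1 \<oplus> ?t1"])
    show "?s1 \<oplus> ?t1 \<in> carrier R" using st by simp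
  next
    fix v assume v: "v \<in> carrier P" "e v = \<zero>\<^bsub>X\<^esub>"
    then have "?\<pi> (g0 v) = \<zero>\<^bsub>?C\<^esub>"
      using g0(2)[OF v(1)] module_hom_zero[OF lm(1,5) g] by simp
    from fun_cong[OF this, of 0] show "g0 v 0 \<otimes> c = \<zero>" by simp
  next
    fix x assume x: "x \<in> carrier R" "x \<otimes> c = \<zero>"
    then show "e (f0 (\<lambda>_. x)) = \<zero>\<^bsub>X\<^esub>"
      using f0(2)[OF cst[OF x(1)]] module_hom_zero[OF lm(5,1) f] by simp
    have "?t (\<lambda>_. x) = (\<lambda>_. \<zero>)"
      using x module_hom_zero[OF lm(5,3) \<alpha>] module_hom_zero[OF lm(3,4) b(1)] by simp
    then have "x \<otimes> ?t1 = \<zero>" using val[OF t cst[OF x(1)]] by (simp add: fun_eq_iff)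
    then show "x \<otimes> (?s1 \<oplus> ?t1) = ?s (\<lambda>_. x) 0"
      using val[OF s cst[OF x(1)]] st x by (simp add: r_distr)
  next
    let ?c = "\<lambda>_::nat. c"
    have cC: "?c \<in> carrier ?C" using module_homD(1)[OF \<pi> 1] c by simp
    have "?\<pi> (?s (\<lambda>_. \<one>)) = g (f ?c)"
      using g0(2)[OF module_homD(1)[OF f0(1) 1]] f0(2)[OF 1] c by simp
    from fun_cong[OF this, of 0] have 2: "?s1 \<otimes> c = g (f ?c) 0" .
    have "?\<pi> (?t (\<lambda>_. \<one>)) = \<beta> (\<alpha> ?c)"
      using b(2)[OF module_homD(1)[OF \<alpha> cC]] c by simp
    from fun_cong[OF this, of 0] have 3: "?t1 \<otimes> c = \<beta> (\<alpha> ?c) 0" .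
    have "(?s1 \<oplus> ?t1) \<otimes> c = (g (f ?c) \<oplus>\<^bsub>?C\<^esub> \<beta> (\<alpha> ?c)) 0"
      using st c 2 3 by (simp add: l_distr)
    also have "\<dots> = c" using fun_cong[OF id[OF cC, symmetric], of 0] by simp
    finally show "(?s1 \<oplus> ?t1) \<otimes> c = c" .
  qed
qed

section \<open>Chains of syzygies\<close>

text \<open>Each \<open>R c\<^sub>n\<^sub>+\<^sub>1\<close> is a direct summand of the syzygy \<open>{u. u c\<^sub>n = 0}\<close> of \<open>R c\<^sub>n\<close>, with
  projection \<open>\<rho> n\<close>.\<close>

locale syzygy_chain = plain_ring R for R :: "'r ring" (structure) +
  fixes c :: "nat \<Rightarrow> 'r" and \<rho> :: "nat \<Rightarrow> 'r \<Rightarrow> 'r"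
  assumes c_closed: "c n \<in> carrier R"
    and c_mult: "c (Suc n) \<otimes> c n = \<zero>"
    and \<rho>_image: "\<lbrakk>u \<in> carrier R; u \<otimes> c n = \<zero>\<rbrakk> \<Longrightarrow> \<exists>x\<in>carrier R. \<rho> n u = x \<otimes> c (Suc n)"
    and \<rho>_add: "\<lbrakk>u \<in> carrier R; u \<otimes> c n = \<zero>; v \<in> carrier R; v \<otimes> c n = \<zero>\<rbrakk> \<Longrightarrow>
      \<rho> n (u \<oplus> v) = \<rho> n u \<oplus> \<rho> n v"
    and \<rho>_mult: "\<lbrakk>a \<in> carrier R; u \<in> carrier R; u \<otimes> c n = \<zero>\<rbrakk> \<Longrightarrow> \<rho> n (a \<otimes> u) = a \<otimes> \<rho> n u"
    and \<rho>_c: "\<rho> n (c (Suc n)) = c (Suc n)"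
    and nonsplit: "\<lbrakk>y \<in> carrier R; y \<otimes> c n = c n\<rbrakk> \<Longrightarrow> c (Suc n) \<otimes> y \<noteq> \<zero>"
begin

text \<open>Additivity and linearity of \<rho> are available only on elements annihilating
  \<open>c n\<close>, so \<rho> is composed with maps that land there. Both maps onto the summand in
  the syzygy step arise this way.\<close>

lemma \<rho>_hom:
  assumes h: "\<And>v. v \<in> carrier M \<Longrightarrow> h v \<in> carrier R"
    "\<And>v. v \<in> carrier M \<Longrightarrow> h v \<otimes> c n = \<zero>"
    "\<And>v w. v \<in> carrier M \<Longrightarrow> w \<in> carrier M \<Longrightarrow> h (v \<oplus>\<^bsub>M\<^esub> w) = h v \<oplus> h w"
    "\<And>a v. a \<in> carrier R \<Longrightarrow> v \<in> carrier M \<Longrightarrow> h (a \<odot>\<^bsub>M\<^esub> v) = a \<otimes> h v"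
  shows "(\<lambda>v _. \<rho> n (h v)) \<in> module_hom R M (cyclic_module R (c (Suc n)))"
proof (rule module_homI)
  fix v assume "v \<in> carrier M"
  from \<rho>_image[OF h(1,2)[OF this]] have "\<exists>x\<in>carrier R. \<rho> n (h v) = x \<otimes> c (Suc n)" .
  then show "(\<lambda>_. \<rho> n (h v)) \<in> carrier (cyclic_module R (c (Suc n)))"
    by (auto simp: cyclic_module_carrier)
qed (simp_all add: h \<rho>_add \<rho>_mult)

text \<open>The induction passes from X to the kernel of \<open>e : P 0 -> X\<close> and from
  \<open>c i\<close> to \<open>c (Suc i)\<close>, so X and i vary. Stable retracts are used because
  the kernel depends on the chosen resolution, while the relation survives any choice.\<close>

lemma no_resolution_stable_retract:
  assumes "fg_left_module R X" "has_projective_resolution R X n"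
  shows "\<not> stable_retract R (cyclic_module R (c i)) X"
  using assms
proof (induction n arbitrary: X i)
  case (0 X i)
  show ?case
  proof
    assume sr: "stable_retract R (cyclic_module R (c i)) X"
    obtain P d e where P: "\<And>i. projective_module R (P i)"
      and z: "\<And>i. i > 0 \<Longrightarrow> carrier (P i) = {\<zero>\<^bsub>P i\<^esub>}"
      and e: "e \<in> module_hom R (P 0) X" "e ` carrier (P 0) = carrier X"
      and d: "\<And>i. d i \<in> module_hom R (P (Suc i)) (P i)" "d 0 ` carrier (P 1) = a_kernel (P 0) X e"
        "\<And>i. d (Suc i) ` carrier (P (Suc (Suc i))) = a_kernel (P (Suc i)) (P i) (d i)"
      by (rule has_projective_resolutionE[OF 0(2)]) (rule that)
    have lm: "left_module R (P i)" for i
      using P by (auto simp: projective_module_def fg_left_module_def)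
    obtain f g y where f: "f \<in> module_hom R (cyclic_module R \<one>) (P 0)"
      and g: "g \<in> module_hom R (P 0) (cyclic_module R \<one>)"
      and y: "y \<in> carrier R"
      and gk: "\<And>v. v \<in> carrier (P 0) \<Longrightarrow> e v = \<zero>\<^bsub>X\<^esub> \<Longrightarrow> g v 0 \<otimes> c i = \<zero>"
      and fk: "\<And>x. x \<in> carrier R \<Longrightarrow> x \<otimes> c i = \<zero> \<Longrightarrow> e (f (\<lambda>_. x)) = \<zero>\<^bsub>X\<^esub>"
      and yc: "y \<otimes> c i = c i"
      and fg: "\<And>x. x \<in> carrier R \<Longrightarrow> x \<otimes> c i = \<zero> \<Longrightarrow> x \<otimes> y = g (f (\<lambda>_. x)) 0"
      by (rule stable_retract_lift[OF c_closed 0(1) P e sr]) (rule that)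
    let ?c = "c (Suc i)"
    have "(\<lambda>_. ?c) \<in> carrier (cyclic_module R \<one>)"
      by (simp add: cyclic_module_one_carrier c_closed)
    then have "f (\<lambda>_. ?c) \<in> a_kernel (P 0) X e"
      using fk[OF c_closed c_mult] module_homD(1)[OF f] by (simp add: a_kernel_def')
    \<comment> \<open>\<open>P 1\<close> is zero, hence so is the image of \<open>d 0\<close>, which
      is the kernel of \<open>e\<close>.\<close>
    then have "f (\<lambda>_. ?c) = \<zero>\<^bsub>P 0\<^esub>"
      using d(2) z[of 1] module_hom_zero[OF lm lm d(1)[of 0]] by auto
    then have "g (f (\<lambda>_. ?c)) = (\<lambda>_. \<zero>)"
      using module_hom_zero[OF lm left_module_cyclic g] by simp
    then have "?c \<otimes> y = \<zero>" using fg[OF c_closed c_mult] by simp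
    then show False using nonsplit[OF y yc] by simp
  qed
next
  case (Suc n X i)
  show ?case
  proof
    assume sr: "stable_retract R (cyclic_module R (c i)) X"
    obtain P d e where P: "\<And>i. projective_module R (P i)"
      and z: "\<And>i. i > Suc n \<Longrightarrow> carrier (P i) = {\<zero>\<^bsub>P i\<^esub>}"
      and e: "e \<in> module_hom R (P 0) X" "e ` carrier (P 0) = carrier X"
      and d: "\<And>i. d i \<in> module_hom R (P (Suc i)) (P i)" "d 0 ` carrier (P 1) = a_kernel (P 0) X e"
        "\<And>i. d (Suc i) ` carrier (P (Suc (Suc i))) = a_kernel (P (Suc i)) (P i) (d i)"
      by (rule has_projective_resolutionE[OF Suc.prems(2)]) (rule that)
    have lm: "left_module R (P i)" "fg_left_module R (P i)" for i
      using P by (auto simp: projective_module_def fg_left_module_def)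
    define X' where "X' = (P 0)\<lparr>carrier := a_kernel (P 0) X e\<rparr>"
    have X'_simps: "carrier X' = a_kernel (P 0) X e" "add X' = add (P 0)" "module.smult X' = module.smult (P 0)"
      "zero X' = zero (P 0)" by (simp_all add: X'_def)
    have lmX: "left_module R X" using Suc.prems(1) by (simp add: fg_left_module_def)
    have lmX': "left_module R X'"
      unfolding X'_def by (rule left_module_kernel[OF lm(1) lmX e(1)])
    have d0: "d 0 \<in> module_hom R (P 1) X'" "d 0 ` carrier (P 1) = carrier X'"
    proof -
      show "d 0 \<in> module_hom R (P 1) X'"
      proof (rule module_homI)
        fix x assume "x \<in> carrier (P 1)"
        then show "d 0 x \<in> carrier X'" using d(2) unfolding X'_simps by blast
      qed (use module_homD[OF d(1)[of 0]] in \<open>simp_all add: X'_simps\<close>)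
    qed (use d(2) in \<open>simp add: X'_simps\<close>)
    have fgX': "fg_left_module R X'"
      by (rule fg_left_module_image[OF lm(2) lmX' d0])
    \<comment> \<open>Dropping \<open>P 0\<close> shortens the resolution by one: \<open>d 0\<close>
      becomes the augmentation onto the syzygy X'.\<close>
    have "has_projective_resolution R X' n"
      unfolding has_projective_resolution_def
    proof (intro exI conjI allI impI)
      show "d 0 \<in> module_hom R (P (Suc 0)) X'" "d 0 ` carrier (P (Suc 0)) = carrier X'"
        using d0 by simp_all
      show "(\<lambda>i. d (Suc i)) 0 ` carrier ((\<lambda>i. P (Suc i)) 1) = a_kernel ((\<lambda>i. P (Suc i)) 0) X' (d 0)"
        using d(3)[of 0] by (simp add: a_kernel_def' X'_simps)
    qed (use P z d in simp_all)
    moreover have "stable_retract R (cyclic_module R (c (Suc i))) X'"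
    proof -
      let ?E = "cyclic_module R \<one>" and ?c = "c (Suc i)"
      let ?C = "cyclic_module R ?c"
      obtain f g y where f: "f \<in> module_hom R (cyclic_module R \<one>) (P 0)"
        and g: "g \<in> module_hom R (P 0) (cyclic_module R \<one>)"
        and y: "y \<in> carrier R"
        and gk: "\<And>v. v \<in> carrier (P 0) \<Longrightarrow> e v = \<zero>\<^bsub>X\<^esub> \<Longrightarrow> g v 0 \<otimes> c i = \<zero>"
        and fk: "\<And>x. x \<in> carrier R \<Longrightarrow> x \<otimes> c i = \<zero> \<Longrightarrow> e (f (\<lambda>_. x)) = \<zero>\<^bsub>X\<^esub>"
        and yc: "y \<otimes> c i = c i"
        and fg: "\<And>x. x \<in> carrier R \<Longrightarrow> x \<otimes> c i = \<zero> \<Longrightarrow> x \<otimes> y = g (f (\<lambda>_. x)) 0"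
        by (rule stable_retract_lift[OF c_closed Suc.prems(1) P e sr]) (rule that)
      \<comment> \<open>Split v = v y + v z with z = 1 - y. On R \<open>c (Suc i)\<close> the part v
        y passes through X', and v z passes through the free module. Both annihilate
        \<open>c i\<close>, so \<rho> brings them back to R \<open>c (Suc i)\<close>, where it fixes
        v.\<close>
      define z where "z = \<ominus> y \<oplus> \<one>"
      have z: "z \<in> carrier R" "z \<otimes> c i = \<zero>" "y \<oplus> z = \<one>"
        using y yc c_closed by (simp_all add: z_def l_distr l_minus l_neg r_neg2)
      have C: "\<exists>x. x \<in> carrier R \<and> x \<otimes> ?c \<in> carrier R \<and> (x \<otimes> ?c) \<otimes> c i = \<zero> \<and> v = (\<lambda>_. x \<otimes> ?c)"
        if "v \<in> carrier ?C" for v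
        using that by (auto simp: cyclic_module_carrier c_closed c_mult m_assoc)
      have CE: "v \<in> carrier ?E" if "v \<in> carrier ?C" for v
        using C[OF that] by (auto simp: cyclic_module_one_carrier)
      have gE: "g v 0 \<in> carrier R" if "v \<in> carrier (P 0)" for v
        using module_homD(1)[OF g that] by (rule cyclic_module_one_coeff)
      have \<rho>C: "\<rho> i (x \<otimes> ?c) = x \<otimes> ?c" if "x \<in> carrier R" for x
        using \<rho>_mult[OF that c_closed c_mult] by (simp add: \<rho>_c)
      show ?thesis
        unfolding stable_retract_def
      proof (intro exI conjI ballI)
        show "projective_module R ?E" by (rule projective_cyclic_one)
        show "(\<lambda>v. v) \<in> module_hom R ?C ?E"
          by (rule module_homI) (simp_all add: CE)
        show "(\<lambda>v _. \<rho> i (v 0 \<otimes> z)) \<in> module_hom R ?E ?C"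
          by (rule \<rho>_hom)
            (use z c_closed in \<open>simp_all add: cyclic_module_one_coeff m_assoc l_distr\<close>)
        show "f \<in> module_hom R ?C X'"
        proof (rule module_homI)
          fix v assume v: "v \<in> carrier ?C"
          then have "e (f v) = \<zero>\<^bsub>X\<^esub>" using C[OF v] fk by blast
          then show "f v \<in> carrier X'"
            using module_homD(1)[OF f CE[OF v]] by (simp add: X'_simps a_kernel_def')
        qed (use module_homD[OF f] CE in \<open>simp_all add: X'_simps\<close>)
        show "(\<lambda>v _. \<rho> i (g v 0)) \<in> module_hom R X' ?C"
          by (rule \<rho>_hom)
            (use gk gE module_homD[OF g] in \<open>auto simp: X'_simps a_kernel_def'\<close>)
      next
        fix v assume v: "v \<in> carrier ?C"
        then obtain x where x: "x \<in> carrier R" "x \<otimes> ?c \<in> carrier R" "(x \<otimes> ?c) \<otimes> c i = \<zero>" "v = (\<lambda>_. x \<otimes> ?c)"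
          using C by blast
        have fv: "f v \<in> carrier (P 0)" "e (f v) = \<zero>\<^bsub>X\<^esub>"
          using module_homD(1)[OF f CE[OF v]] x fk by simp_all
        have "\<rho> i (g (f v) 0) \<oplus> \<rho> i (v 0 \<otimes> z) = \<rho> i (g (f v) 0 \<oplus> v 0 \<otimes> z)"
          by (rule \<rho>_add[symmetric]) (use x z c_closed gE[OF fv(1)] gk[OF fv] in \<open>simp_all add: m_assoc\<close>)
        also have "g (f v) 0 \<oplus> v 0 \<otimes> z = x \<otimes> ?c"
          using fg[OF x(2,3), symmetric] r_distr[OF y z(1) x(2), symmetric] x z by simp
        also have "\<rho> i (x \<otimes> ?c) = x \<otimes> ?c" by (rule \<rho>C[OF x(1)])
        finally show "v = (\<lambda>_. \<rho> i (g (f v) 0)) \<oplus>\<^bsub>?C\<^esub> (\<lambda>_. \<rho> i (v 0 \<otimes> z))"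
          using x(4) by simp
      qed
    qed
    ultimately show False using Suc.IH[OF fgX'] by blast
  qed
qed

text \<open>The module R \<open>c 0\<close> is a stable retract of itself, so it has no projective
  resolution of finite length.\<close>

theorem gl_dim_infinite: "gl_dim R = \<infinity>"
proof -
  let ?C = "cyclic_module R (c 0)"
  have C: "fg_left_module R ?C" by (rule fg_left_module_cyclic[OF c_closed])
  then interpret C: left_module R ?C by (simp add: fg_left_module_def)
  have "stable_retract R ?C ?C"
    unfolding stable_retract_def
  proof (intro exI conjI ballI)
    \<comment> \<open>The correction term is the zero map through the free module.\<close>
    show "projective_module R (cyclic_module R \<one>)" by (rule projective_cyclic_one)
    show "(\<lambda>_. \<zero>\<^bsub>cyclic_module R \<one>\<^esub>) \<in> module_hom R ?C (cyclic_module R \<one>)"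
      by (rule module_homI) (simp_all add: cyclic_module_one_carrier)
    show "(\<lambda>_. \<zero>\<^bsub>?C\<^esub>) \<in> module_hom R (cyclic_module R \<one>) ?C"
      using C.M.zero_closed by (intro module_homI) simp_all
    show "(\<lambda>v. v) \<in> module_hom R ?C ?C" by (rule module_homI) (rule refl | assumption)+
    \<comment> \<open>Both maps of the retraction are the identity, which yields the same goal
      twice.\<close>
    then show "(\<lambda>v. v) \<in> module_hom R ?C ?C" .
    fix v assume "v \<in> carrier ?C"
    then show "v = v \<oplus>\<^bsub>?C\<^esub> \<zero>\<^bsub>?C\<^esub>" by (simp only: C.M.r_zero)
  qed
  then have "\<not> has_projective_resolution R ?C n" for n
    using no_resolution_stable_retract[OF C] by blast
  then have "proj_dim R ?C = \<infinity>" by (simp add: proj_dim_def top_enat_def)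
  then have "\<infinity> \<le> gl_dim R"
    unfolding gl_dim_def using C by (intro SUP_upper2[of ?C]) auto
  then show ?thesis by simp
qed

end

section \<open>Elements of path algebras\<close>

text \<open>Coefficients are indexed by triples with end points, while \<open>Pa\<close> and
  \<open>minimal_for\<close> speak of arrow lists. This translates between the two; it is meaningful
  for non-empty lists, since \<open>psrc\<close> and \<open>ptgt\<close> use \<open>hd\<close> and
  \<open>last\<close>.\<close>

definition qpath_of :: "('v, 'a) pre_digraph \<Rightarrow> 'a list \<Rightarrow> ('v, 'a) qpath" where
  "qpath_of Q p = (psrc Q p, p, ptgt Q p)"

lemma fst_qpath_of [simp]: "fst (qpath_of Q p) = psrc Q p"
  and arcs_qpath_of [simp]: "fst (snd (qpath_of Q p)) = p"
  and snd_qpath_of [simp]: "snd (snd (qpath_of Q p)) = ptgt Q p"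
  by (simp_all add: qpath_of_def)

lemma path_elem_eq: "path_elem Q p = basis_elem (qpath_of Q p)"
  by (simp add: path_elem_def qpath_of_def)

lemma (in pre_digraph) qpath_ends:
  assumes "x \<in> qpaths G" "fst (snd x) \<noteq> []"
  shows "fst x = psrc G (fst (snd x))" "snd (snd x) = ptgt G (fst (snd x))"
proof -
  have *: "cas u p v \<Longrightarrow> p \<noteq> [] \<Longrightarrow> u = tail G (hd p) \<and> v = head G (last p)" for u p v
  proof (induction p arbitrary: u)
    case (Cons a p)
    then show ?case by (cases p) auto
  qed simp
  show "fst x = psrc G (fst (snd x))" "snd (snd x) = ptgt G (fst (snd x))"
    using assms * by (auto simp: qpaths_def awalk_def psrc_def ptgt_def)
qed

lemma (in pre_digraph) is_path_iff: "is_path G p \<longleftrightarrow> p \<noteq> [] \<and> qpath_of G p \<in> qpaths G"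
  by (simp add: is_path_def qpaths_def qpath_of_def)

lemma (in wf_digraph) qpath_prefix:
  assumes "(u, xs @ p, v) \<in> qpaths G" "p \<noteq> []"
  shows "(u, xs, psrc G p) \<in> qpaths G" "v = ptgt G p"
proof -
  have w: "awalk u xs (awlast u xs)" "awalk (awlast u xs) p v"
    using assms(1) by (simp_all add: qpaths_def)
  then have "awlast u xs = psrc G p" "v = ptgt G p"
    using qpath_ends[of "(awlast u xs, p, v)"] assms(2) by (simp_all add: qpaths_def)
  then show "(u, xs, psrc G p) \<in> qpaths G" "v = ptgt G p"
    using w by (simp_all add: qpaths_def)
qed

section \<open>Multiplication by a single path\<close>

lemma path_algebra_carrier:
  "f \<in> carrier (path_algebra Q) \<longleftrightarrow> finite {x. f x \<noteq> 0} \<and> {x. f x \<noteq> 0} \<subseteq> qpaths Q"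
  by (simp add: path_algebra_def)

lemma path_algebra_add: "f \<oplus>\<^bsub>path_algebra Q\<^esub> g = (\<lambda>r. f r + g r)"
  and path_algebra_zero: "\<zero>\<^bsub>path_algebra Q\<^esub> = (\<lambda>r. 0)"
  by (simp_all add: path_algebra_def)

lemma supp_single: "{y. (if y = x then k else 0) \<noteq> 0} \<subseteq> {x}"
  by auto

lemma single_mult:
  assumes "snd (snd x) = fst y"
  shows "(\<lambda>z. if z = x then k else 0) \<otimes>\<^bsub>path_algebra Q\<^esub> (\<lambda>z. if z = y then l else 0)
    = (\<lambda>z. if z = qpath_comp x y then k * l else (0::'k::field))"
  by (rule ext, subst path_algebra_mult_superset[OF _ _ supp_single supp_single])
    (use assms in \<open>auto simp: is_qpath_comp_def qpath_comp_def\<close>)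

lemma basis_elem_mult:
  assumes "snd (snd x) = fst y"
  shows "basis_elem x \<otimes>\<^bsub>path_algebra Q\<^esub> basis_elem y
    = (basis_elem (qpath_comp x y) :: _ \<Rightarrow> 'k::field)"
  using single_mult[OF assms, where k = 1 and l = 1 and Q = Q] by (simp add: basis_elem_def cong: if_cong)

lemma qpath_comp_inject_left:
  "\<lbrakk>qpath_comp x w = qpath_comp y w; snd (snd x) = fst w; snd (snd y) = fst w\<rbrakk> \<Longrightarrow> x = y"
  by (cases x; cases y) (auto simp: qpath_comp_def)

lemma qpath_comp_inject_right:
  "\<lbrakk>qpath_comp w x = qpath_comp w y; snd (snd w) = fst x; snd (snd w) = fst y\<rbrakk> \<Longrightarrow> x = y"
  by (cases x; cases y) (auto simp: qpath_comp_def)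

text \<open>Concatenation with w can be cancelled, so x is the only path that contributes to the
  coefficient at x w.\<close>

lemma coeff_mult_basis_elem:
  assumes f: "f \<in> carrier (path_algebra Q)" and x: "snd (snd x) = fst w"
  shows "(f \<otimes>\<^bsub>path_algebra Q\<^esub> basis_elem w) (qpath_comp x w) = (f x :: 'k::field)"
proof -
  \<comment> \<open>x is adjoined to the support so that the sum picks out \<open>f x\<close> even
    when that coefficient is 0.\<close>
  let ?S = "insert x {x. f x \<noteq> 0}"
  have fin: "finite ?S" using f by (simp add: path_algebra_carrier)
  have *: "is_qpath_comp y w (qpath_comp x w) \<longleftrightarrow> y = x" for y
    using x qpath_comp_inject_left[of x w y]
    by (auto simp: is_qpath_comp_def qpath_comp_def[symmetric])
  have "(f \<otimes>\<^bsub>path_algebra Q\<^esub> basis_elem w) (qpath_comp x w) =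
    (\<Sum>y\<in>?S. \<Sum>z\<in>{w}. if is_qpath_comp y z (qpath_comp x w) then f y * basis_elem w z else 0)"
    by (rule path_algebra_mult_superset[OF fin]) (auto simp: basis_elem_def)
  also have "\<dots> = (\<Sum>y\<in>?S. if y = x then f y else 0)"
    by (rule sum.cong) (simp_all add: * basis_elem_def cong: if_cong)
  also have "\<dots> = f x" by (subst sum.delta[OF fin]) simp
  finally show ?thesis .
qed

lemma coeff_basis_elem_mult:
  assumes f: "f \<in> carrier (path_algebra Q)" and x: "snd (snd w) = fst x"
  shows "(basis_elem w \<otimes>\<^bsub>path_algebra Q\<^esub> f) (qpath_comp w x) = (f x :: 'k::field)"
proof -
  let ?S = "insert x {x. f x \<noteq> 0}"
  have fin: "finite ?S" using f by (simp add: path_algebra_carrier)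
  have *: "is_qpath_comp w y (qpath_comp w x) \<longleftrightarrow> y = x" for y
    using x qpath_comp_inject_right[of w x y]
    by (auto simp: is_qpath_comp_def qpath_comp_def[symmetric])
  have "(basis_elem w \<otimes>\<^bsub>path_algebra Q\<^esub> f) (qpath_comp w x) =
    (\<Sum>z\<in>{w}. \<Sum>y\<in>?S. if is_qpath_comp z y (qpath_comp w x) then basis_elem w z * f y else 0)"
    by (rule path_algebra_mult_superset[OF _ fin]) (auto simp: basis_elem_def)
  also have "\<dots> = (\<Sum>y\<in>?S. if y = x then f y else 0)"
    by (simp add: * basis_elem_def cong: if_cong)
  also have "\<dots> = f x" by (subst sum.delta[OF fin]) simp
  finally show ?thesis .
qed

context wf_digraph
begin

lemma single_closed: "x \<in> qpaths G \<Longrightarrow> (\<lambda>y. if y = x then k else 0) \<in> carrier (path_algebra G)"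
  using finite_subset[OF supp_single] by (auto simp: path_algebra_carrier)

lemma basis_elem_closed: "x \<in> qpaths G \<Longrightarrow> basis_elem x \<in> carrier (path_algebra G)"
  using single_closed[of x 1] by (simp add: basis_elem_def)

text \<open>Induction on the support, splitting off one monomial at a time. The condition
  \<open>f x = 0\<close> excludes cancellation, so that the support of f stays inside that of the
  sum.\<close>

lemma path_algebra_induct [consumes 1, case_names zero add]:
  assumes f: "f \<in> carrier (path_algebra G)"
    and zero: "P (\<lambda>_. 0)"
    and add: "\<And>x k f. \<lbrakk>x \<in> qpaths G; f \<in> carrier (path_algebra G); f x = 0; P f\<rbrakk> \<Longrightarrow>
      P ((\<lambda>y. if y = x then k else 0) \<oplus>\<^bsub>path_algebra G\<^esub> f)"
  shows "P f"
proof -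
  have "finite {x. f x \<noteq> 0}" using f by (simp add: path_algebra_carrier)
  then show ?thesis using f
  proof (induction "{x. f x \<noteq> 0}" arbitrary: f rule: finite_psubset_induct)
    case psubset
    show ?case
    proof (cases "\<exists>x. f x \<noteq> 0")
      case False
      then have "f = (\<lambda>_. 0)" by auto
      then show ?thesis using zero by simp
    next
      case True
      then obtain x where x: "f x \<noteq> 0" by blast
      let ?g = "f(x := 0)"
      have sub: "{y. ?g y \<noteq> 0} \<subset> {y. f y \<noteq> 0}" using x by auto
      have g: "?g \<in> carrier (path_algebra G)"
        using psubset.prems finite_subset[of "{y. ?g y \<noteq> 0}" "{y. f y \<noteq> 0}"] sub
        by (simp add: path_algebra_carrier) blast
      have "x \<in> qpaths G" using psubset.prems x by (auto simp: path_algebra_carrier)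
      from add[OF this g _ psubset.hyps(2)[OF sub g], of "f x"]
      have "P ((\<lambda>y. if y = x then f x else 0) \<oplus>\<^bsub>path_algebra G\<^esub> ?g)" by simp
      also have "(\<lambda>y. if y = x then f x else 0) \<oplus>\<^bsub>path_algebra G\<^esub> ?g = f"
        by (auto simp: path_algebra_add)
      finally show ?thesis .
    qed
  qed
qed

end

section \<open>Selecting the paths with a given ending\<close>

definition ends_in :: "'a list \<Rightarrow> (('v, 'a) qpath \<Rightarrow> 'k) \<Rightarrow> ('v, 'a) qpath \<Rightarrow> 'k::zero" where
  "ends_in p f = (\<lambda>x. if suffix p (fst (snd x)) then f x else 0)"

lemma ends_in_supp: "{x. ends_in p f x \<noteq> 0} \<subseteq> {x. f x \<noteq> 0}"
  by (auto simp: ends_in_def)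

lemma ends_in_closed: "f \<in> carrier (path_algebra Q) \<Longrightarrow> ends_in p f \<in> carrier (path_algebra Q)"
  using ends_in_supp[of p f] by (auto simp: path_algebra_carrier dest: finite_subset)

lemma ends_in_add:
  "ends_in p (f \<oplus>\<^bsub>path_algebra Q\<^esub> g) = ends_in p f \<oplus>\<^bsub>path_algebra Q\<^esub> ends_in p g"
  by (auto simp: ends_in_def path_algebra_add)

text \<open>A path ending in p factors as x' p; removing p from each selected monomial produces
  g.\<close>

lemma (in fin_digraph) ends_in_image:
  fixes f :: "('a, 'b) qpath \<Rightarrow> 'k::field"
  assumes "f \<in> carrier (path_algebra G)" "p \<noteq> []"
  shows "\<exists>g\<in>carrier (path_algebra G). ends_in p f = g \<otimes>\<^bsub>path_algebra G\<^esub> path_elem G p"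
  using assms(1)
proof (induction f rule: path_algebra_induct)
  interpret ring "path_algebra G :: (('a, 'b) qpath \<Rightarrow> 'k) ring" by (rule ring_path_algebra)
  {
    case zero
    have "(\<lambda>_. 0) \<otimes>\<^bsub>path_algebra G\<^esub> path_elem G p = (\<lambda>_. 0::'k)"
      by (rule ext) (simp add: path_algebra_mult_conv)
    moreover have "(\<lambda>_. 0) \<in> carrier (path_algebra G :: (('a, 'b) qpath \<Rightarrow> 'k) ring)"
      by (simp add: path_algebra_carrier)
    ultimately show ?case by (auto simp: ends_in_def intro!: bexI[of _ "\<lambda>_. 0"])
  next
    case (add x k f)
    let ?s = "\<lambda>y. if y = x then k else 0"
    obtain g where g: "g \<in> carrier (path_algebra G)"
      "ends_in p f = g \<otimes>\<^bsub>path_algebra G\<^esub> path_elem G p" using add.IH by blast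
    show ?case
    proof (cases "suffix p (fst (snd x))")
      case False
      then have "ends_in p (?s \<oplus>\<^bsub>path_algebra G\<^esub> f) = ends_in p f"
        by (intro ext) (auto simp: ends_in_def path_algebra_add)
      then show ?thesis using g by auto
    next
      case True
      then obtain u xs v where x: "x = (u, xs @ p, v)"
        by (metis prod.collapse suffixE)
      note pre = qpath_prefix[OF add(1)[unfolded x] assms(2)]
      let ?x = "(u, xs, psrc G p)"
      let ?t = "\<lambda>y. if y = ?x then k else 0"
      have xc: "x = qpath_comp ?x (qpath_of G p)"
        using pre by (simp add: x qpath_comp_def)
      have t: "?t \<in> carrier (path_algebra G)" using pre(1) by (rule single_closed)
      have "qpath_of G p \<in> qpaths G"
        using add(1) pre assms(2) unfolding x qpaths_def qpath_of_def
        by simp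
      then have pe: "path_elem G p \<in> carrier (path_algebra G :: (('a, 'b) qpath \<Rightarrow> 'k) ring)"
        by (simp add: path_elem_eq basis_elem_closed)
      have "?t \<otimes>\<^bsub>path_algebra G\<^esub> path_elem G p = ?s"
        unfolding path_elem_eq basis_elem_def xc by (subst single_mult) (simp_all cong: if_cong)
      also have "?s = ends_in p ?s" using True by (intro ext) (auto simp: ends_in_def)
      finally have "ends_in p (?s \<oplus>\<^bsub>path_algebra G\<^esub> f)
        = (?t \<oplus>\<^bsub>path_algebra G\<^esub> g) \<otimes>\<^bsub>path_algebra G\<^esub> path_elem G p"
        using g t pe by (simp add: ends_in_add l_distr)
      then show ?thesis using t g by blast
    qed
  }
qed

section \<open>Monomial ideals in path algebras\<close>

locale monomial_ideal = fin_digraph G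
  for G :: "('v, 'a) pre_digraph" +
  fixes I :: "(('v, 'a) qpath \<Rightarrow> 'k::field) set" and Z :: "'a list set"
  assumes Z_paths: "p \<in> Z \<Longrightarrow> is_path G p"
    and I_gen: "I = genideal (path_algebra G) (path_elem G ` Z)"
begin

abbreviation "kQ \<equiv> path_algebra G :: (('v, 'a) qpath \<Rightarrow> 'k) ring"

sublocale kQ: ring kQ by (rule ring_path_algebra)

lemma gens_closed: "path_elem G ` Z \<subseteq> carrier kQ"
  using Z_paths by (auto simp: path_elem_eq is_path_iff intro!: basis_elem_closed)

sublocale ideal I kQ
  unfolding I_gen by (rule kQ.genideal_ideal[OF gens_closed])

text \<open>I is a k-subspace: an ideal of a ring has no scalars of its own, but scaling a path by k
  is left multiplication by k times the trivial path at its source.\<close>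

lemma mem_if_supp:
  assumes "f \<in> carrier kQ" "\<And>x. f x \<noteq> 0 \<Longrightarrow> basis_elem x \<in> I"
  shows "f \<in> I"
  using assms
proof (induction f rule: path_algebra_induct)
  case zero
  show ?case using additive_subgroup.zero_closed[OF additive_subgroup_axioms]
    by (simp add: path_algebra_zero)
next
  case (add x k f)
  let ?s = "\<lambda>y. if y = x then k else 0"
  have "f \<in> I"
  proof (rule add.IH)
    fix y assume "f y \<noteq> 0"
    with \<open>f x = 0\<close> have "(?s \<oplus>\<^bsub>kQ\<^esub> f) y \<noteq> 0" by (auto simp: path_algebra_add)
    then show "basis_elem y \<in> I" by (rule add.prems)
  qed
  moreover have "?s \<in> I"
  \<comment> \<open>For k = 0 the path x need not occur in the sum, so the hypothesis says nothing
    about it.\<close>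
  proof (cases "k = 0")
    case True
    then have "?s = \<zero>\<^bsub>kQ\<^esub>" by (auto simp: path_algebra_zero)
    then show ?thesis using additive_subgroup.zero_closed[OF additive_subgroup_axioms] by metis
  next
    case False
    let ?e = "(fst x, [], fst x)"
    have "(?s \<oplus>\<^bsub>kQ\<^esub> f) x \<noteq> 0" using False \<open>f x = 0\<close> by (simp add: path_algebra_add)
    then have x: "basis_elem x \<in> I" by (rule add.prems)
    have e: "?e \<in> qpaths G" using \<open>x \<in> qpaths G\<close> by (auto simp: qpaths_def awalk_Nil_iff)
    have "qpath_comp ?e x = x" by (simp add: qpath_comp_def)
    then have "(\<lambda>y. if y = ?e then k else 0) \<otimes>\<^bsub>kQ\<^esub> basis_elem x = ?s"
      unfolding basis_elem_def by (subst single_mult) (simp_all cong: if_cong)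
    then show ?thesis using I_l_closed[OF x single_closed[OF e]] by metis
  qed
  ultimately show ?case using additive_subgroup.a_closed[OF additive_subgroup_axioms] by blast
qed

text \<open>The elements supported on paths in \<open>I\<close> form an ideal that contains the generators.\<close>

lemma mem_iff: "f \<in> I \<longleftrightarrow> f \<in> carrier kQ \<and> (\<forall>x. f x \<noteq> 0 \<longrightarrow> basis_elem x \<in> I)"
proof -
  let ?J = "{f \<in> carrier kQ. \<forall>x. f x \<noteq> 0 \<longrightarrow> basis_elem x \<in> I}"
  have neg: "\<ominus>\<^bsub>kQ\<^esub> f = (\<lambda>r. - f r)" if "f \<in> carrier kQ" for f
    by (rule kQ.minus_equality) (use that in \<open>auto simp: path_algebra_add path_algebra_zero path_algebra_carrier\<close>)
  \<comment> \<open>A path in the support of a product is a concatenation of paths from the two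
    supports, one of which lies in I. The disjunction treats left and right absorption
    together.\<close>
  have mult: "basis_elem r \<in> I"
    if fg: "f \<in> carrier kQ" "g \<in> carrier kQ" and r: "(f \<otimes>\<^bsub>kQ\<^esub> g) r \<noteq> 0"
      and I: "(\<forall>x. f x \<noteq> 0 \<longrightarrow> basis_elem x \<in> I) \<or> (\<forall>x. g x \<noteq> 0 \<longrightarrow> basis_elem x \<in> I)" for f g r
  proof -
    obtain x y where xy: "f x \<noteq> 0" "g y \<noteq> 0" "snd (snd x) = fst y" "r = qpath_comp x y"
      using r path_algebra_mult_support[of G f g] by auto
    then have "x \<in> qpaths G" "y \<in> qpaths G" using fg by (auto simp: path_algebra_carrier)
    then have "basis_elem x \<in> carrier kQ" "basis_elem y \<in> carrier kQ"
      by (simp_all add: basis_elem_closed)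
    then have "basis_elem x \<otimes>\<^bsub>kQ\<^esub> basis_elem y \<in> I"
      using I xy I_l_closed I_r_closed by blast
    then show ?thesis using xy by (simp add: basis_elem_mult)
  qed
  have "ideal ?J kQ"
  proof (rule idealI)
    show "ring kQ" by (rule kQ.ring_axioms)
    show "subgroup ?J (add_monoid kQ)"
    proof
      fix f g assume "f \<in> ?J" "g \<in> ?J"
      then have c: "f \<in> carrier kQ" "g \<in> carrier kQ"
        and I: "\<And>x. f x \<noteq> 0 \<or> g x \<noteq> 0 \<Longrightarrow> basis_elem x \<in> I" by auto
      have "basis_elem x \<in> I" if "(f \<oplus>\<^bsub>kQ\<^esub> g) x \<noteq> 0" for x
        using that I[of x] by (cases "f x = 0") (auto simp: path_algebra_add)
      then show "f \<otimes>\<^bsub>add_monoid kQ\<^esub> g \<in> ?J" using c by simp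
    next
      fix f assume f: "f \<in> ?J"
      then have "\<ominus>\<^bsub>kQ\<^esub> f \<in> ?J" using neg[of f] kQ.a_inv_closed[of f] by auto
      then show "inv\<^bsub>add_monoid kQ\<^esub> f \<in> ?J" by (simp add: a_inv_def)
    qed (auto, simp add: path_algebra_zero)
  qed (auto intro: mult)
  moreover have "path_elem G ` Z \<subseteq> ?J"
  proof -
    have "path_elem G ` Z \<subseteq> I" unfolding I_gen by (rule kQ.genideal_self[OF gens_closed])
    then show ?thesis using gens_closed
      by (auto simp: path_elem_eq basis_elem_def split: if_splits)
  qed
  ultimately have "I \<subseteq> ?J" unfolding I_gen by (rule kQ.genideal_minimal)
  then show ?thesis using mem_if_supp by blast
qed

section \<open>The quotient algebra\<close>

abbreviation "A \<equiv> quiver_algebra G I"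

lemma ring_quiver_algebra: "ring A"
  unfolding quiver_algebra_def by (rule quotient_is_ring)

lemma quotient_simps:
  "f \<in> carrier kQ \<Longrightarrow> g \<in> carrier kQ \<Longrightarrow> (I +>\<^bsub>kQ\<^esub> f) \<otimes>\<^bsub>A\<^esub> (I +>\<^bsub>kQ\<^esub> g) = I +>\<^bsub>kQ\<^esub> (f \<otimes>\<^bsub>kQ\<^esub> g)"
  "f \<in> carrier kQ \<Longrightarrow> g \<in> carrier kQ \<Longrightarrow> (I +>\<^bsub>kQ\<^esub> f) \<oplus>\<^bsub>A\<^esub> (I +>\<^bsub>kQ\<^esub> g) = I +>\<^bsub>kQ\<^esub> (f \<oplus>\<^bsub>kQ\<^esub> g)"
  "\<zero>\<^bsub>A\<^esub> = I"
  by (simp_all add: quiver_algebra_def FactRing_def rcoset_mult_add a_rcos_sum)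

lemma quotient_carrier: "X \<in> carrier A \<longleftrightarrow> (\<exists>f\<in>carrier kQ. X = I +>\<^bsub>kQ\<^esub> f)"
  by (auto simp: quiver_algebra_def FactRing_def A_RCOSETS_def')

lemma coset_mem: "f \<in> carrier kQ \<Longrightarrow> g \<in> I +>\<^bsub>kQ\<^esub> f \<longleftrightarrow> (\<exists>i\<in>I. g = i \<oplus>\<^bsub>kQ\<^esub> f)"
  by (auto simp: a_r_coset_def')

lemma coset_add: "i \<in> I \<Longrightarrow> f \<in> carrier kQ \<Longrightarrow> I +>\<^bsub>kQ\<^esub> (i \<oplus>\<^bsub>kQ\<^esub> f) = I +>\<^bsub>kQ\<^esub> f"
  by (metis kQ.a_repr_independence a_subgroup coset_mem)

lemma coset_eq_zero: "f \<in> carrier kQ \<Longrightarrow> I +>\<^bsub>kQ\<^esub> f = I \<longleftrightarrow> f \<in> I"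
  by (metis a_rcos_const a_rcos_self)

lemma Pa_qpath: "p \<in> Pa G I \<Longrightarrow> p \<noteq> [] \<and> qpath_of G p \<in> qpaths G \<and> basis_elem (qpath_of G p) \<notin> I"
  by (simp add: Pa_def is_path_iff path_elem_eq)

lemma path_elem_closed: "p \<in> Pa G I \<Longrightarrow> path_elem G p \<in> carrier kQ"
  by (simp add: path_elem_eq Pa_qpath basis_elem_closed)

lemma path_class_closed: "p \<in> Pa G I \<Longrightarrow> path_class G I p \<in> carrier A"
  using path_elem_closed by (auto simp: quotient_carrier path_class_def)

text \<open>Distinct paths stay distinct after multiplication by w, so x w occurs in f w with
  coefficient \<open>f x\<close>, and a monomial ideal contains each path occurring in its
  elements.\<close>

lemma mult_path_elem_mem:
  assumes "f \<in> carrier kQ" "f \<otimes>\<^bsub>kQ\<^esub> path_elem G w \<in> I" "f x \<noteq> 0" "snd (snd x) = psrc G w"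
  shows "basis_elem (qpath_comp x (qpath_of G w)) \<in> I"
proof -
  have "(f \<otimes>\<^bsub>kQ\<^esub> path_elem G w) (qpath_comp x (qpath_of G w)) = f x"
    unfolding path_elem_eq by (rule coeff_mult_basis_elem) (use assms in simp_all)
  then show ?thesis using assms(2,3) mem_iff by metis
qed

lemma zero_product_iff:
  assumes "f \<in> carrier kQ" "w \<in> Pa G I"
  shows "(I +>\<^bsub>kQ\<^esub> f) \<otimes>\<^bsub>A\<^esub> path_class G I w = \<zero>\<^bsub>A\<^esub> \<longleftrightarrow> f \<otimes>\<^bsub>kQ\<^esub> path_elem G w \<in> I"
  using assms path_elem_closed[OF assms(2)]
  by (simp add: path_class_def quotient_simps coset_eq_zero)

section \<open>Minimal paths and the projection onto a left ideal\<close>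

text \<open>A path \<open>y\<close> with \<open>y w = 0\<close> that is a proper suffix of \<open>p\<close> contradicts the minimality of \<open>p\<close>.\<close>

lemma minimal_suffix:
  assumes min: "minimal_for G I p w"
    and f: "f \<in> carrier kQ" "f \<otimes>\<^bsub>kQ\<^esub> path_elem G w \<in> I" "f y \<noteq> 0"
    and x: "x \<in> qpaths G" "snd (snd x) = fst y" "suffix p (fst (snd (qpath_comp x y)))"
  shows "suffix p (fst (snd y))"
proof (rule ccontr)
  let ?q = "fst (snd y)"
  assume ns: "\<not> suffix p ?q"
  have p: "p \<in> Pa G I" and w: "w \<in> Pa G I" and pw: "ptgt G p = psrc G w"
    using min by (simp_all add: minimal_for_def)
  have y: "y \<in> qpaths G" using f by (auto simp: path_algebra_carrier)
  have suf: "suffix p (fst (snd x) @ ?q)" using x(3) by (simp add: qpath_comp_def)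
  \<comment> \<open>Two suffixes of one list are comparable, so the arrows of y form a suffix of
    p.\<close>
  moreover have "suffix ?q (fst (snd x) @ ?q)" by (rule suffixI) simp
  ultimately have qp: "suffix ?q p" using ns suffix_same_cases by blast
  show False
  proof (cases "?q = []")
    \<comment> \<open>p ends at the source of w, so y is the trivial path there, and y w = w would
      lie in I.\<close>
    case True
    then have sx: "suffix p (fst (snd x))" using suf by simp
    have pn: "p \<noteq> []" using Pa_qpath[OF p] by simp
    have "snd (snd x) = ptgt G (fst (snd x))"
      using qpath_ends(2)[OF x(1)] sx pn by (auto simp: suffix_def)
    also have "\<dots> = psrc G w" using sx pn pw by (auto simp: suffix_def ptgt_def)
    finally have "fst y = psrc G w" using x(2) by simp
    moreover have "snd (snd y) = fst y" using y True by (auto simp: qpaths_def awalk_Nil_iff)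
    ultimately have "snd (snd y) = psrc G w" "qpath_comp y (qpath_of G w) = qpath_of G w"
      using True by (simp_all add: qpath_comp_def qpath_of_def)
    then show False using mult_path_elem_mem[OF f] Pa_qpath[OF w] by simp
  next
    case False
    have "ptgt G ?q = ptgt G p" using qp False by (auto simp: suffix_def ptgt_def)
    then have t: "snd (snd y) = psrc G w" "ptgt G ?q = psrc G w"
      using qpath_ends(2)[OF y False] pw by simp_all
    have yq: "y = qpath_of G ?q"
      using qpath_ends[OF y False] by (metis prod.collapse qpath_of_def)
    have "basis_elem y \<otimes>\<^bsub>kQ\<^esub> path_elem G w \<in> I"
      using mult_path_elem_mem[OF f t(1)] t(1) by (simp add: path_elem_eq basis_elem_mult)
    then have "zero_product G I ?q w"
      using zero_product_iff[OF basis_elem_closed[OF y] w] yq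
      by (simp add: zero_product_def path_class_def path_elem_eq)
    moreover have "sublist ?q p" "?q \<noteq> p" using qp ns by auto
    ultimately show False using min False t(2) unfolding minimal_for_def by blast
  qed
qed

text \<open>For x in the support of a and y in that of f, the path x y ends in p exactly when y
  does: one direction is \<open>minimal_suffix\<close>, the other is immediate. Hence the selection
  commutes with left multiplication by a.\<close>

lemma ends_in_mult:
  assumes min: "minimal_for G I p w" and a: "a \<in> carrier kQ"
    and f: "f \<in> carrier kQ" "f \<otimes>\<^bsub>kQ\<^esub> path_elem G w \<in> I"
  shows "ends_in p (a \<otimes>\<^bsub>kQ\<^esub> f) = a \<otimes>\<^bsub>kQ\<^esub> ends_in p f"
proof
  fix r
  let ?A = "{x. a x \<noteq> 0}" and ?F = "{x. f x \<noteq> 0}"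
  have fin: "finite ?A" "finite ?F" using a f by (simp_all add: path_algebra_carrier)
  have "(a \<otimes>\<^bsub>kQ\<^esub> ends_in p f) r =
    (\<Sum>x\<in>?A. \<Sum>y\<in>?F. if is_qpath_comp x y r then a x * ends_in p f y else 0)"
    by (rule path_algebra_mult_superset[OF fin order_refl ends_in_supp])
  also have "\<dots> = (\<Sum>x\<in>?A. \<Sum>y\<in>?F. if suffix p (fst (snd r)) then
      (if is_qpath_comp x y r then a x * f y else 0) else 0)"
  proof (intro sum.cong refl)
    fix x y assume xy: "x \<in> ?A" "y \<in> ?F"
    have x: "x \<in> qpaths G" using xy a by (auto simp: path_algebra_carrier)
    have "suffix p (fst (snd r)) \<longleftrightarrow> suffix p (fst (snd y))" if r: "is_qpath_comp x y r"
    proof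
      assume "suffix p (fst (snd r))"
      then show "suffix p (fst (snd y))"
        using minimal_suffix[OF min f _ x] xy r by (auto simp: is_qpath_comp_def qpath_comp_def)
    next
      assume "suffix p (fst (snd y))"
      then show "suffix p (fst (snd r))" using r by (auto simp: is_qpath_comp_def suffix_appendI)
    qed
    then show "(if is_qpath_comp x y r then a x * ends_in p f y else 0) =
      (if suffix p (fst (snd r)) then (if is_qpath_comp x y r then a x * f y else 0) else 0)"
      by (auto simp: ends_in_def)
  qed
  also have "\<dots> = ends_in p (a \<otimes>\<^bsub>kQ\<^esub> f) r"
    by (simp add: ends_in_def path_algebra_mult_conv)
  finally show "ends_in p (a \<otimes>\<^bsub>kQ\<^esub> f) r = (a \<otimes>\<^bsub>kQ\<^esub> ends_in p f) r" by simp
qed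

text \<open>Transfers \<open>ends_in\<close> to cosets through a chosen representative;
  \<open>suffix_proj_coset\<close> removes the choice.\<close>

definition suffix_proj :: "'a list \<Rightarrow> (('v, 'a) qpath \<Rightarrow> 'k) set \<Rightarrow> (('v, 'a) qpath \<Rightarrow> 'k) set" where
  "suffix_proj p X = I +>\<^bsub>kQ\<^esub> ends_in p (SOME f. f \<in> X)"

text \<open>Since I is monomial, selecting paths keeps its elements in I, so two representatives
  give the same coset.\<close>

lemma suffix_proj_coset:
  assumes f: "f \<in> carrier kQ"
  shows "suffix_proj p (I +>\<^bsub>kQ\<^esub> f) = I +>\<^bsub>kQ\<^esub> ends_in p f"
proof -
  have "(SOME g. g \<in> I +>\<^bsub>kQ\<^esub> f) \<in> I +>\<^bsub>kQ\<^esub> f"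
    by (rule someI[of "\<lambda>g. g \<in> I +>\<^bsub>kQ\<^esub> f" f]) (rule a_rcos_self[OF f])
  then obtain i where i: "i \<in> I" "(SOME g. g \<in> I +>\<^bsub>kQ\<^esub> f) = i \<oplus>\<^bsub>kQ\<^esub> f"
    using coset_mem[OF f] by blast
  have "ends_in p i \<in> I"
    using i(1) ends_in_closed[of i G p] ends_in_supp[of p i] unfolding mem_iff[of i] mem_iff[of "ends_in p i"]
    by blast
  then show ?thesis
    using i ends_in_closed[OF f] by (simp add: suffix_proj_def ends_in_add coset_add)
qed

lemma syzygy_chain_paths:
  assumes min: "\<And>n. minimal_for G I (s (Suc n)) (s n)"
  shows "syzygy_chain A (\<lambda>n. path_class G I (s n)) (\<lambda>n. suffix_proj (s (Suc n)))"
proof -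
  interpret A: ring A by (rule ring_quiver_algebra)
  have s: "s n \<in> Pa G I" for n using min[of n] by (simp add: minimal_for_def)
  note pe = path_elem_closed[OF s]
  have ker: "f \<otimes>\<^bsub>kQ\<^esub> path_elem G (s n) \<in> I"
    if "f \<in> carrier kQ" "(I +>\<^bsub>kQ\<^esub> f) \<otimes>\<^bsub>A\<^esub> path_class G I (s n) = \<zero>\<^bsub>A\<^esub>" for f n
    using that zero_product_iff[OF _ s] by simp
  show ?thesis
  proof
    fix n
    show "path_class G I (s n) \<in> carrier A" by (rule path_class_closed[OF s])
    show "path_class G I (s (Suc n)) \<otimes>\<^bsub>A\<^esub> path_class G I (s n) = \<zero>\<^bsub>A\<^esub>"
      using min[of n] by (simp add: minimal_for_def zero_product_def)
    have "suffix (s (Suc n)) (s (Suc n))" by simp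
    then have "ends_in (s (Suc n)) (path_elem G (s (Suc n))) = (path_elem G (s (Suc n)) :: _ \<Rightarrow> 'k)"
      by (intro ext) (auto simp: ends_in_def path_elem_eq basis_elem_def)
    then show "suffix_proj (s (Suc n)) (path_class G I (s (Suc n))) = path_class G I (s (Suc n))"
      by (simp add: path_class_def suffix_proj_coset[OF pe])
  next
    fix n X assume "X \<in> carrier A"
    then obtain f where f: "f \<in> carrier kQ" "X = I +>\<^bsub>kQ\<^esub> f" by (auto simp: quotient_carrier)
    obtain g where "g \<in> carrier kQ" "ends_in (s (Suc n)) f = g \<otimes>\<^bsub>kQ\<^esub> path_elem G (s (Suc n))"
      using ends_in_image[OF f(1)] Pa_qpath[OF s] by blast
    then show "\<exists>Y\<in>carrier A. suffix_proj (s (Suc n)) X = Y \<otimes>\<^bsub>A\<^esub> path_class G I (s (Suc n))"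
      using f pe by (intro bexI[of _ "I +>\<^bsub>kQ\<^esub> g"])
        (auto simp: suffix_proj_coset path_class_def quotient_simps quotient_carrier)
  next
    fix n X Y assume "X \<in> carrier A" "Y \<in> carrier A"
    then obtain f g where fg: "f \<in> carrier kQ" "X = I +>\<^bsub>kQ\<^esub> f" "g \<in> carrier kQ" "Y = I +>\<^bsub>kQ\<^esub> g"
      by (auto simp: quotient_carrier)
    then show "suffix_proj (s (Suc n)) (X \<oplus>\<^bsub>A\<^esub> Y) =
        suffix_proj (s (Suc n)) X \<oplus>\<^bsub>A\<^esub> suffix_proj (s (Suc n)) Y"
      by (simp add: quotient_simps suffix_proj_coset ends_in_add ends_in_closed)
  next
    fix n a X assume "a \<in> carrier A" "X \<in> carrier A" and X: "X \<otimes>\<^bsub>A\<^esub> path_class G I (s n) = \<zero>\<^bsub>A\<^esub>"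
    then obtain b f where bf: "b \<in> carrier kQ" "a = I +>\<^bsub>kQ\<^esub> b" "f \<in> carrier kQ" "X = I +>\<^bsub>kQ\<^esub> f"
      by (auto simp: quotient_carrier)
    then show "suffix_proj (s (Suc n)) (a \<otimes>\<^bsub>A\<^esub> X) = a \<otimes>\<^bsub>A\<^esub> suffix_proj (s (Suc n)) X"
      using ker[OF bf(3)] X ends_in_mult[OF min bf(1,3)]
      by (simp add: quotient_simps suffix_proj_coset ends_in_closed)
  next
    fix n y assume "y \<in> carrier A" and y: "y \<otimes>\<^bsub>A\<^esub> path_class G I (s n) = path_class G I (s n)"
    then obtain f where f: "f \<in> carrier kQ" "y = I +>\<^bsub>kQ\<^esub> f" by (auto simp: quotient_carrier)
    let ?w = "qpath_of G (s n)" and ?p = "qpath_of G (s (Suc n))"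
    \<comment> \<open>The coefficient of f at this trivial path appears twice: at
      \<open>s (Suc n)\<close> in the product \<open>s (Suc n)\<close> f, which lies in I and thus
      forces it to be 0, and at \<open>s n\<close> in the product f \<open>s n\<close>.\<close>
    let ?e = "(psrc G (s n), [], psrc G (s n))"
    have st: "ptgt G (s (Suc n)) = psrc G (s n)" using min[of n] by (simp add: minimal_for_def)
    show "path_class G I (s (Suc n)) \<otimes>\<^bsub>A\<^esub> y \<noteq> \<zero>\<^bsub>A\<^esub>"
    proof
      assume "path_class G I (s (Suc n)) \<otimes>\<^bsub>A\<^esub> y = \<zero>\<^bsub>A\<^esub>"
      then have "path_elem G (s (Suc n)) \<otimes>\<^bsub>kQ\<^esub> f \<in> I"
        using f pe by (simp add: path_class_def quotient_simps coset_eq_zero)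
      moreover have "(path_elem G (s (Suc n)) \<otimes>\<^bsub>kQ\<^esub> f) (qpath_comp ?p ?e) = f ?e"
        unfolding path_elem_eq by (rule coeff_basis_elem_mult[OF f(1)]) (simp add: st)
      moreover have "qpath_comp ?p ?e = ?p" by (simp add: qpath_comp_def qpath_of_def st)
      ultimately have "f ?e = 0" using Pa_qpath[OF s] mem_iff by metis
      moreover have "(f \<otimes>\<^bsub>kQ\<^esub> path_elem G (s n)) (qpath_comp ?e ?w) = f ?e"
        unfolding path_elem_eq by (rule coeff_mult_basis_elem[OF f(1)]) simp
      moreover have "qpath_comp ?e ?w = ?w" by (simp add: qpath_comp_def qpath_of_def)
      ultimately have 0: "(f \<otimes>\<^bsub>kQ\<^esub> path_elem G (s n)) ?w = 0" by simp
      \<comment> \<open>The equation y c = c holds only modulo I. The difference i would have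
        coefficient 1 at \<open>s n\<close>, although that path is not in I.\<close>
      have "I +>\<^bsub>kQ\<^esub> (f \<otimes>\<^bsub>kQ\<^esub> path_elem G (s n)) = I +>\<^bsub>kQ\<^esub> path_elem G (s n)"
        using y f pe by (simp add: path_class_def quotient_simps)
      then have "path_elem G (s n) \<in> I +>\<^bsub>kQ\<^esub> (f \<otimes>\<^bsub>kQ\<^esub> path_elem G (s n))"
        using a_rcos_self[OF pe] by simp
      then obtain i where i: "i \<in> I" "path_elem G (s n) = i \<oplus>\<^bsub>kQ\<^esub> (f \<otimes>\<^bsub>kQ\<^esub> path_elem G (s n))"
        using coset_mem f pe by auto
      have "path_elem G (s n) ?w = (1::'k)" by (simp add: path_elem_eq basis_elem_def)
      then have "i ?w = 1" using 0 i(2) by (metis add.right_neutral path_algebra_add)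
      then show False using i(1) Pa_qpath[OF s] mem_iff by (metis zero_neq_one)
    qed
  qed
qed

end

section \<open>From a cycle of minimal relations to infinite global dimension\<close>

lemma Pa_c_chain:
  assumes "p \<in> Pa_c Q I"
  obtains s where "\<And>n. minimal_for Q I (s (Suc n)) (s n)"
  using assms unfolding Pa_c_def
proof (elim CollectE conjE exE bexE)
  fix m j and P :: "nat \<Rightarrow> _"
  assume m: "\<forall>i\<in>{1..m}. minimal_for Q I (P i) (P (i + 1))"
    and j: "j \<in> {1..m + 1}" "minimal_for Q I (P j) (P 1)"
  \<comment> \<open>The index starts at 1, jumps to j and descends to 1 again, over and over. Each
    descent uses that \<open>P i\<close> is minimal for \<open>P (i + 1)\<close>, each jump that
    \<open>P j\<close> is minimal for \<open>P 1\<close>.\<close>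
  define k where "k = rec_nat 1 (\<lambda>_ i. if i = 1 then j else i - 1)"
  have k: "k n \<in> {1..m + 1}" for n
    by (induction n) (use j(1) in \<open>auto simp: k_def\<close>)
  have k_Suc: "k (Suc n) = (if k n = 1 then j else k n - 1)" for n
    by (simp add: k_def)
  have "minimal_for Q I (P (k (Suc n))) (P (k n))" for n
  proof (cases "k n = 1")
    case True
    then show ?thesis using j(2) by (simp add: k_Suc)
  next
    case False
    then have "k n - 1 \<in> {1..m}" using k[of n] by auto
    from bspec[OF m this] False show ?thesis using k[of n] by (simp add: k_Suc)
  qed
  then show ?thesis by (rule that[of "\<lambda>n. P (k n)"])
qed

theorem theorem50:
  fixes Q :: "('v, 'a) pre_digraph"
    and I :: "(('v, 'a) qpath \<Rightarrow> 'k::alg_closed_field) set"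
    and GSt :: "('v, 'a) gstring set"
  assumes "string_algebra Q I"
    and "is_GSt Q I GSt"
    and "GSt_lower_cp Q I GSt \<noteq> {} \<or> GSt_upper_cp Q I GSt \<noteq> {}"
  shows "gl_dim (quiver_algebra Q I) = \<infinity>"
proof -
  obtain Z where Z: "\<And>p. p \<in> Z \<Longrightarrow> is_path Q p" "I = genideal (path_algebra Q) (path_elem Q ` Z)"
    and fin: "fin_digraph Q"
    using assms(1) unfolding string_algebra_def by blast
  interpret monomial_ideal Q I Z
    by (intro monomial_ideal.intro monomial_ideal_axioms.intro fin Z)
  \<comment> \<open>Membership in either special set comes with a witness from
    \<open>Pa_c\<close>.\<close>
  obtain p where "p \<in> Pa_c Q I"
    using assms(3) unfolding GSt_lower_cp_def GSt_upper_cp_def by blast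
  then obtain s where "\<And>n. minimal_for Q I (s (Suc n)) (s n)"
    by (rule Pa_c_chain) (rule that)
  then show ?thesis by (rule syzygy_chain.gl_dim_infinite[OF syzygy_chain_paths])
qed

end
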